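(* Let $n,k$ be integers with $k\geq 8$ and $2k+1\leq n\leq 4k$. Suppose that $\mathcal{F},\mathcal{G}\subset \binom{[n]}{k}$ are cross-intersecting and both are non-trivial. Then \[ |\mathcal{F}||\mathcal{G}|\leq \left(\binom{n-1}{k-1}-\binom{n-k-1}{k-1}+1\right)^2 . \]
   Context: $[n]=\{1,2,\ldots,n\}$ and $\binom{[n]}{k}$ denotes the family of all $k$-element subsets of $[n]$. Two families $\mathcal{F},\mathcal{G}$ are cross-intersecting if $F\cap G\neq\emptyset$ for all $F\in\mathcal{F}$, $G\in\mathcal{G}$. A family $\mathcal{F}$ is non-trivial if $\bigcap\{F\colon F\in\mathcal{F}\}=\emptyset$. *)

theory Defs
  imports Main
begin

definition cross_intersecting :: "'a set set \<Rightarrow> 'a set set \<Rightarrow> bool" where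
  "cross_intersecting F G \<longleftrightarrow> (\<forall>A\<in>F. \<forall>B\<in>G. A \<inter> B \<noteq> {})"

definition non_trivial :: "'a set set \<Rightarrow> bool" where
  "non_trivial F \<longleftrightarrow> \<Inter> F = {}"

end

theory Submission
  imports Defs "HOL-Analysis.Convex"
begin

text \<open>
  Split both families at an element \<open>i\<close> into the sets containing \<open>i\<close> and the sets avoiding \<open>i\<close>.
  If the avoiding parts are nonempty and not larger than about \<open>R = (n - 2 choose (k - 1))\<close>, the
  Kruskal--Katona theorem gives \<open>|F(i)| + |G(not i)| \<le> h\<close> and \<open>|G(i)| + |F(not i)| \<le> h\<close>, where
  \<open>h\<close> is the Hilton--Milner number, and the arithmetic-geometric mean inequality finishes.

  Shift both families. If shifting makes one of them trivial, it is covered by two elements, and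
  the bound follows from three such sums over the remaining \<open>n - 2\<close> elements. Otherwise both are
  shifted; take \<open>i = 1\<close> and suppose that, say, \<open>a = |F(not 1)|\<close> is large and that
  \<open>b = |G(not 1)| \<le> a\<close>. Kruskal--Katona also bounds \<open>|F(1)| b\<close> and \<open>|G(1)| a\<close> by about the
  product \<open>Q\<close> of two stars on \<open>n - 1\<close> elements, and \<open>G(1)\<close> contains the shadow of \<open>G(not 1)\<close>.
  Hence \<open>|F| |G| \<le> Q\<^sup>2 / (a b) + 2 Q + a b\<close> is small unless \<open>a b\<close> is small, in which case \<open>G\<close> is
  too small. For \<open>n > 3 k\<close> the product \<open>a b\<close> is always small, by Frankl's lattice walk argument.
\<close>

section \<open>Shifting and the Kruskal--Katona theorem\<close>

text \<open>Cross-intersection enters mostly through complements: with \<open>l = k - 1\<close> and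
  \<open>r = n - k - 1\<close>, a link avoids the level-\<open>l\<close> shadow of the
  \<open>r\<close>-element complements of the other deletion. A single set in that deletion already
  costs \<open>r choose l\<close> sets of the link, which is where \<open>h = S - E + 1\<close>
  comes from. The real index in Lovasz' form makes the excess of the shadow over the family a
  function on an interval, whose minimum can be sought at the two ends.

  The obstacle is that the sum bound fails for large deletions: if all sets contain another element,
  a link and a deletion can add up to \<open>S\<close>, which exceeds \<open>h\<close>. Such pairs
  are controlled by products, and there the room is narrow: for \<open>n <= 3 k\<close> the margin
  obtained, relative to \<open>S^2\<close>, is only \<open>(r - l) / (2 k^3)\<close>. It suffices
  because \<open>E / S\<close> decays exponentially in \<open>k\<close>, at worst like
  \<open>(5/7)^l\<close> when \<open>n <= 4 k\<close>. Hence large \<open>k\<close> is settled by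
  estimates and small \<open>k\<close> by a finite check.\<close>

definition shadow :: "nat \<Rightarrow> 'a set set \<Rightarrow> 'a set set" where
  "shadow l K = {B. card B = l \<and> (\<exists>A\<in>K. B \<subseteq> A)}"

definition shift_set :: "'a \<Rightarrow> 'a \<Rightarrow> 'a set \<Rightarrow> 'a set" where
  "shift_set i j A = (if j \<in> A \<and> i \<notin> A then insert i (A - {j}) else A)"

definition shift :: "'a \<Rightarrow> 'a \<Rightarrow> 'a set set \<Rightarrow> 'a set set" where
  "shift i j F = shift_set i j ` F \<union> {A \<in> F. shift_set i j A \<in> F}"

lemma shift_set_idem: "shift_set i j (shift_set i j A) = shift_set i j A"
  by (auto simp: shift_set_def)

lemma card_shift_set:
  assumes "finite A"
  shows "card (shift_set i j A) = card A"
proof (cases "j \<in> A \<and> i \<notin> A")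
  case True
  then have "card (insert i (A - {j})) = Suc (card (A - {j}))" using assms by simp
  also have "\<dots> = card A" using True card.remove[OF assms, of j] by simp
  finally show ?thesis using True by (simp add: shift_set_def)
next
  case False
  then have "shift_set i j A = A" by (simp only: shift_set_def if_False)
  then show ?thesis by simp
qed

lemma shift_cases:
  assumes "A \<in> shift i j F"
  obtains "A \<in> F" "shift_set i j A \<in> F"
  | A0 where "A0 \<in> F" "j \<in> A0" "i \<notin> A0" "A = insert i (A0 - {j})"
  using assms unfolding shift_def shift_set_def by (auto split: if_splits)

lemma shift_set_in_shift: "A \<in> F \<Longrightarrow> shift_set i j A \<in> shift i j F"
  unfolding shift_def by blast

text \<open>The bijection keeps the blocked sets and moves the others; a moved set is recovered from
  its new image by putting \<open>j\<close> back in place of \<open>i\<close>. The explicit map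
  serves both for sizes and for comparing sums of elements.\<close>

lemma bij_betw_shift:
  "bij_betw (\<lambda>A. if shift_set i j A \<in> F then A else shift_set i j A) F (shift i j F)"
proof -
  let ?\<sigma> = "shift_set i j"
  let ?f = "\<lambda>A. if ?\<sigma> A \<in> F then A else ?\<sigma> A"
  have "inj_on ?f F"
  proof (rule inj_onI)
    fix A B assume A: "A \<in> F" and B: "B \<in> F" and eq: "?f A = ?f B"
    have inj: "A' = B'" if "?\<sigma> A' = ?\<sigma> B'" "?\<sigma> A' \<notin> F" "A' \<in> F" "B' \<in> F" for A' B'
      using that unfolding shift_set_def by (auto split: if_splits)
    show "A = B"
      using A B eq inj[of A B] by (auto split: if_splits)
  qed
  moreover have "?f ` F = shift i j F"
  proof
    show "?f ` F \<subseteq> shift i j F" by (auto simp: shift_def)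
    show "shift i j F \<subseteq> ?f ` F"
    proof
      fix A assume "A \<in> shift i j F"
      then consider (1) "A \<in> F" "?\<sigma> A \<in> F" | (2) B where "B \<in> F" "A = ?\<sigma> B"
        unfolding shift_def by auto
      then show "A \<in> ?f ` F"
      proof cases
        case 1 then show ?thesis by (auto intro!: image_eqI[of _ _ A])
      next
        case 2
        show ?thesis
        proof (cases "A \<in> F")
          case True
          then have "?\<sigma> A \<in> F" using 2 by (simp add: shift_set_idem)
          then show ?thesis using True by (auto intro!: image_eqI[of _ _ A])
        next
          case False
          then show ?thesis using 2 by (auto intro!: image_eqI[of _ _ B])
        qed
      qed
    qed
  qed
  ultimately show ?thesis by (simp add: bij_betw_def)
qed

lemma card_shift: "card (shift i j F) = card F"
  using bij_betw_same_card[OF bij_betw_shift] by metis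

lemma shift_uniform:
  assumes "F \<subseteq> {A. A \<subseteq> X \<and> card A = k}" "finite X" "i \<in> X"
  shows "shift i j F \<subseteq> {A. A \<subseteq> X \<and> card A = k}"
proof
  fix A assume "A \<in> shift i j F"
  then consider "A \<in> F" | B where "B \<in> F" "A = shift_set i j B"
    unfolding shift_def by auto
  then show "A \<in> {A. A \<subseteq> X \<and> card A = k}"
  proof cases
    case 1 then show ?thesis using assms by auto
  next
    case 2
    have B: "B \<subseteq> X" "card B = k" using 2 assms(1) by auto
    then have "card A = k" using 2 card_shift_set finite_subset[OF B(1) assms(2)] by auto
    moreover have "A \<subseteq> X" using 2 B assms(3) by (auto simp: shift_set_def split: if_splits)
    ultimately show ?thesis by simp
  qed
qed

text \<open>A subset \<open>B\<close> of a moved set \<open>insert i (A0 - {j})\<close> either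
  misses \<open>i\<close> and lies in \<open>A0\<close> itself, or is the image of the subset of
  \<open>A0\<close> that has \<open>j\<close> in place of \<open>i\<close>. Below a set that stays,
  \<open>B\<close> and its image are both in the shadow, because that set and its image both belong
  to \<open>K\<close>.\<close>

lemma shadow_shift:
  assumes "\<And>A. A \<in> K \<Longrightarrow> finite A"
  shows "shadow s (shift i j K) \<subseteq> shift i j (shadow s K)"
proof
  fix B assume "B \<in> shadow s (shift i j K)"
  then obtain A where A: "A \<in> shift i j K" "B \<subseteq> A" and cB: "card B = s"
    by (auto simp: shadow_def)
  have keep: "B \<in> shift i j (shadow s K)" if "B \<in> shadow s K" "shift_set i j B \<in> shadow s K"
    using that by (auto simp: shift_def)
  from A(1) show "B \<in> shift i j (shadow s K)"
  proof (cases rule: shift_cases)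
    case 1
    have fB: "finite B" using finite_subset[OF A(2) assms[OF 1(1)]] .
    have "shift_set i j B \<subseteq> A \<or> shift_set i j B \<subseteq> shift_set i j A"
      using A(2) by (auto simp: shift_set_def)
    then have "shift_set i j B \<in> shadow s K"
      using 1 cB card_shift_set[OF fB] by (auto simp: shadow_def)
    moreover have "B \<in> shadow s K" using 1 A cB by (auto simp: shadow_def)
    ultimately show ?thesis by (rule keep[rotated])
  next
    case (2 A0)
    have "finite A" using assms[OF 2(1)] 2(4) by simp
    then have fB: "finite B" using finite_subset[OF A(2)] by simp
    show ?thesis
    proof (cases "i \<in> B")
      case True
      let ?C = "insert j (B - {i})"
      have ij: "i \<noteq> j" using 2 by auto
      have jB: "j \<notin> B" using A(2) 2 ij by auto
      have "?C \<subseteq> A0" using A(2) 2 by auto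
      moreover have "card ?C = s"
        using cB fB True jB card_shift_set[OF fB, of j i] by (simp add: shift_set_def)
      ultimately have "?C \<in> shadow s K" using 2 by (auto simp: shadow_def)
      moreover have "shift_set i j ?C = B" using True jB ij by (auto simp: shift_set_def)
      ultimately show ?thesis using shift_set_in_shift[of ?C "shadow s K" i j] by simp
    next
      case False
      have "B \<subseteq> A0" using A(2) 2 False by auto
      then have "B \<in> shadow s K" using 2 cB by (auto simp: shadow_def)
      moreover have "j \<notin> B" using A(2) 2 False by auto
      then have "shift_set i j B = B" by (simp add: shift_set_def)
      ultimately show ?thesis using keep by simp
    qed
  qed
qed

text \<open>The critical pair is a set \<open>A\<close> that stayed and a set \<open>B\<close> moved
  from \<open>B0\<close>. If they were disjoint, \<open>A\<close> would meet \<open>B0\<close> only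
  in \<open>j\<close> and avoid \<open>i\<close>, so its own image, which also belongs to the
  family, would miss \<open>B0\<close>.\<close>

lemma shift_cross_intersecting:
  assumes "cross_intersecting F G"
  shows "cross_intersecting (shift i j F) (shift i j G)"
proof -
  have *: "A \<inter> B \<noteq> {}"
    if c: "cross_intersecting F' G'" and A: "A \<in> F'" "shift_set i j A \<in> F'"
      and B: "B0 \<in> G'" "j \<in> B0" "i \<notin> B0" "B = insert i (B0 - {j})" for F' G' A B B0
  proof
    assume e: "A \<inter> B = {}"
    have "A \<inter> B0 \<noteq> {}" using c A(1) B(1) unfolding cross_intersecting_def by blast
    then have j: "j \<in> A" "i \<notin> A" using e B by auto
    then have "shift_set i j A \<inter> B0 = {}" using e B by (auto simp: shift_set_def)
    then show False using c A(2) B(1) unfolding cross_intersecting_def by blast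
  qed
  have sym: "cross_intersecting G F" using assms unfolding cross_intersecting_def by blast
  show ?thesis
    unfolding cross_intersecting_def
  proof (intro ballI)
    fix A B assume A: "A \<in> shift i j F" and B: "B \<in> shift i j G"
    from A show "A \<inter> B \<noteq> {}"
    proof (cases rule: shift_cases)
      case A1: 1
      from B show ?thesis
      proof (cases rule: shift_cases)
        case 1 then show ?thesis using A1 assms unfolding cross_intersecting_def by blast
      next
        case (2 B0) then show ?thesis using *[OF assms A1 2] by blast
      qed
    next
      case A2: (2 A0)
      from B show ?thesis
      proof (cases rule: shift_cases)
        case 1 then show ?thesis using *[OF sym 1 A2] by blast
      next
        case (2 B0) then show ?thesis using A2 by blast
      qed
    qed
  qed
qed

lemma finite_shadow:
  assumes "finite K" "\<And>A. A \<in> K \<Longrightarrow> finite A"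
  shows "finite (shadow s K)"
proof -
  have "shadow s K \<subseteq> Pow (\<Union>K)" by (auto simp: shadow_def)
  moreover have "finite (Pow (\<Union>K))" using assms by auto
  ultimately show ?thesis by (rule finite_subset)
qed

lemma finite_uniform: "finite X \<Longrightarrow> F \<subseteq> {A. A \<subseteq> X \<and> card A = k} \<Longrightarrow> finite F"
  by (rule finite_subset[of _ "Pow X"]) auto

lemma gchoose_nonneg:
  fixes x :: real
  assumes "real k - 1 \<le> x"
  shows "0 \<le> x gchoose k"
  unfolding gbinomial_prod_rev
proof (intro divide_nonneg_nonneg prod_nonneg ballI)
  fix i assume "i \<in> {0..<k}"
  then show "0 \<le> x - real i" using assms by simp
qed simp

lemma gchoose_mono:
  fixes x y :: real
  assumes "real k - 1 \<le> x" "x \<le> y"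
  shows "x gchoose k \<le> y gchoose k"
  unfolding gbinomial_prod_rev
proof (intro divide_right_mono prod_mono ballI conjI)
  fix i assume "i \<in> {0..<k}"
  then show "0 \<le> x - real i" "x - real i \<le> y - real i" using assms by simp_all
qed simp

text \<open>Lovasz' form of the Kruskal--Katona theorem, by Frankl's argument: after compressing
  towards \<open>z\<close>, the shadow of the sets avoiding \<open>z\<close> lies in the link of \<open>z\<close>.\<close>

lemma exists_compressed:
  assumes K: "K \<subseteq> {A. A \<subseteq> X \<and> card A = r}" and X: "finite X" and z: "z \<in> \<Union>K"
  obtains K' where "K' \<subseteq> {A. A \<subseteq> X \<and> card A = r}" "card K' = card K" "z \<in> \<Union>K'"
    "card (shadow s K') \<le> card (shadow s K)" "\<And>j. j \<in> X \<Longrightarrow> shift z j K' = K'"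
proof -
  let ?P = "\<lambda>K'. K' \<subseteq> {A. A \<subseteq> X \<and> card A = r} \<and> card K' = card K \<and> z \<in> \<Union>K' \<and>
    card (shadow s K') \<le> card (shadow s K)"
  \<comment> \<open>The compressed family maximises the number of members through \<open>z\<close>:
    a shift towards \<open>z\<close> keeps those members, and whenever it changes the family it adds
    a new one.\<close>
  let ?m = "\<lambda>K'. card {A \<in> K'. z \<in> A}"
  have P: "?P K" using K z by simp
  have bd: "\<forall>L. ?P L \<longrightarrow> ?m L < Suc (card (Pow X))"
  proof (intro allI impI)
    fix L assume "?P L"
    then have "{A \<in> L. z \<in> A} \<subseteq> Pow X" by auto
    then show "?m L < Suc (card (Pow X))" by (meson X card_mono finite_Pow_iff le_imp_less_Suc)
  qed
  obtain K' where K': "?P K'" and max: "\<And>L. ?P L \<Longrightarrow> ?m L \<le> ?m K'"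
    using Lattices_Big.ex_has_greatest_nat[of ?P K ?m, OF P bd] by blast
  have zX: "z \<in> X" using K z by auto
  have fin: "\<And>L. L \<subseteq> {A. A \<subseteq> X \<and> card A = r} \<Longrightarrow> finite L" using finite_uniform[OF X] by blast
  have "shift z j K' = K'" if j: "j \<in> X" for j
  proof (rule ccontr)
    assume ne: "shift z j K' \<noteq> K'"
    let ?L = "shift z j K'"
    have fK: "finite K'" using K' fin by blast
    have fA: "finite A" if "A \<in> K'" for A
    proof -
      have "A \<subseteq> X" using that K' by blast
      then show ?thesis using finite_subset[OF _ X] by simp
    qed
    have u: "?L \<subseteq> {A. A \<subseteq> X \<and> card A = r}"
      by (rule shift_uniform[OF _ X zX]) (use K' in blast)
    have c: "card ?L = card K'" by (rule card_shift)
    have sub: "{A \<in> K'. z \<in> A} \<subseteq> {A \<in> ?L. z \<in> A}"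
      by (auto simp: shift_def shift_set_def)
    have "\<not> ?L \<subseteq> K'" using ne c fK card_subset_eq by blast
    then obtain A where A: "A \<in> ?L" "A \<notin> K'" by blast
    from A(1) have "z \<in> A" by (cases rule: shift_cases) (use A in auto)
    then have "{A \<in> K'. z \<in> A} \<subset> {A \<in> ?L. z \<in> A}" using sub A by blast
    then have lt: "?m K' < ?m ?L" using fin[OF u] by (intro psubset_card_mono) auto
    have "card (shadow s ?L) \<le> card (shift z j (shadow s K'))"
      by (rule card_mono[OF _ shadow_shift])
        (auto simp: shift_def intro!: finite_shadow fK fA)
    also have "\<dots> = card (shadow s K')"
      by (rule card_shift)
    finally have "?P ?L" using u c K' \<open>z \<in> A\<close> A by auto
    then show False using max[of ?L] lt by simp
  qed
  then show ?thesis using K' that by blast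
qed

theorem kruskal_katona_lovasz:
  assumes "K \<subseteq> {A. A \<subseteq> X \<and> card A = Suc s}" "finite X" "K \<noteq> {}"
    and "real s \<le> x" "x gchoose (Suc s) \<le> card K"
  shows "x gchoose s \<le> card (shadow s K)"
  using assms
proof (induction "s + card K" arbitrary: s K x rule: less_induct)
  case (less s K x)
  note X = less.prems(2)
  have fin: "\<And>L. L \<subseteq> {A. A \<subseteq> X \<and> card A = Suc s} \<Longrightarrow> finite L" using finite_uniform[OF X] by blast
  have fs: "finite (shadow s L)" if "L \<subseteq> {A. A \<subseteq> X \<and> card A = Suc s}" for L
    using finite_shadow[OF fin[OF that]] finite_subset[OF _ X] that by auto
  have small: "real (Suc s) \<le> card (shadow s L)"
    if L: "L \<subseteq> {A. A \<subseteq> X \<and> card A = Suc s}" "L \<noteq> {}" for L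
  proof -
    obtain A where A: "A \<in> L" using L by blast
    have A': "finite A" "card A = Suc s" using A L finite_subset[OF _ X] by auto
    have "{B. B \<subseteq> A \<and> card B = s} \<subseteq> shadow s L" using A by (auto simp: shadow_def)
    then have "card {B. B \<subseteq> A \<and> card B = s} \<le> card (shadow s L)" using fs[OF L(1)] card_mono by blast
    then show ?thesis using n_subsets[OF A'(1), of s] A' by simp
  qed
  have small': "y gchoose s \<le> card (shadow s L)"
    if "L \<subseteq> {A. A \<subseteq> X \<and> card A = Suc s}" "L \<noteq> {}" "real s - 1 \<le> y" "y \<le> real s + 1" for L y
  proof -
    have "y gchoose s \<le> real (Suc s) gchoose s" by (rule gchoose_mono) (use that in auto)
    also have "\<dots> = real (Suc s)" by (metis binomial_Suc_n binomial_gbinomial)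
    finally show ?thesis using small[OF that(1,2)] by linarith
  qed
  show ?case
  \<comment> \<open>Up to \<open>x = s + 1\<close> the \<open>s + 1\<close> facets of one member
    suffice. Beyond it, \<open>x - 1\<close> is still large enough for both uses of the induction
    hypothesis; for \<open>s = 0\<close> there is no level below.\<close>
  proof (cases "x \<le> real s + 1 \<or> s = 0")
    case True
    then show ?thesis
    proof
      assume "x \<le> real s + 1"
      then show ?thesis using small'[OF less.prems(1,3)] less.prems(4) by simp
    next
      assume "s = 0"
      then show ?thesis using small[OF less.prems(1,3)] by simp
    qed
  next
    case False
    then have xs: "real s + 1 < x" and s0: "s > 0" by auto
    obtain A0 where "A0 \<in> K" using less.prems(3) by blast
    then have "A0 \<noteq> {}" using less.prems(1) by auto
    then obtain z where "z \<in> \<Union>K" using \<open>A0 \<in> K\<close> by blast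
    then obtain K' where K': "K' \<subseteq> {A. A \<subseteq> X \<and> card A = Suc s}" "card K' = card K" "z \<in> \<Union>K'"
      "card (shadow s K') \<le> card (shadow s K)" "\<And>j. j \<in> X \<Longrightarrow> shift z j K' = K'"
      using exists_compressed[OF less.prems(1) X, where s = s] by blast
    have fK': "finite K'" using fin K'(1) by blast
    define L where "L = (\<lambda>A. A - {z}) ` {A \<in> K'. z \<in> A}"
    define M where "M = {A \<in> K'. z \<notin> A}"
    have cL: "card L = card {A \<in> K'. z \<in> A}"
      unfolding L_def by (rule card_image) (auto simp: inj_on_def)
    have part: "card K' = card L + card M"
    proof -
      have "K' = {A \<in> K'. z \<in> A} \<union> M" by (auto simp: M_def)
      moreover have "card ({A \<in> K'. z \<in> A} \<union> M) = card {A \<in> K'. z \<in> A} + card M"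
        by (rule card_Un_disjoint) (use fK' in \<open>auto simp: M_def\<close>)
      ultimately show ?thesis unfolding cL by simp
    qed
    have Lne: "L \<noteq> {}" using K'(3) by (auto simp: L_def)
    have fL: "finite L" unfolding L_def using fK' by auto
    obtain s' where s': "s = Suc s'" using s0 by (cases s) auto
    have Lu: "L \<subseteq> {A. A \<subseteq> X \<and> card A = Suc s'}"
    proof
      fix B assume "B \<in> L"
      then obtain A where A: "A \<in> K'" "z \<in> A" "B = A - {z}" by (auto simp: L_def)
      then have A': "A \<subseteq> X" "card A = Suc s" using K'(1) by auto
      then show "B \<in> {A. A \<subseteq> X \<and> card A = Suc s'}" using A s' by (auto simp: card_Diff_singleton)
    qed
    have Mu: "M \<subseteq> {A. A \<subseteq> X \<and> card A = Suc s}" using K'(1) by (auto simp: M_def)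
    have shM: "shadow s M \<subseteq> L"
    proof
      fix B assume "B \<in> shadow s M"
      then obtain A where A: "A \<in> K'" "z \<notin> A" "B \<subseteq> A" "card B = s" by (auto simp: shadow_def M_def)
      have fA: "finite A" "card A = Suc s" "A \<subseteq> X" using A(1) K'(1) finite_subset[OF _ X] by auto
      then have "card (A - B) = 1" using A by (simp add: card_Diff_subset finite_subset[of B A])
      then obtain j where j: "A - B = {j}" using card_1_singletonE by blast
      have "shift_set z j A = insert z B" using A j by (auto simp: shift_set_def)
      then have "insert z B \<in> shift z j K'" using shift_set_in_shift[OF A(1), of z j] by simp
      then have "insert z B \<in> K'" using K'(5)[of j] j fA by blast
      then show "B \<in> L" unfolding L_def using A by (auto intro!: image_eqI[of _ _ "insert z B"])
    qed
    have pascal1: "x gchoose Suc s = (x - 1 gchoose s) + (x - 1 gchoose Suc s)"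
      using gbinomial_Suc_Suc[of "x - 1" s] by simp
    have pascal2: "x gchoose s = (x - 1 gchoose s') + (x - 1 gchoose s)"
      using gbinomial_Suc_Suc[of "x - 1" s'] s' by simp
    \<comment> \<open>If the link were smaller, Pascal's rule would make \<open>M\<close> exceed
      \<open>x - 1 gchoose Suc s\<close>; by induction its shadow, which lies in \<open>L\<close>,
      would then have at least \<open>x - 1 gchoose s\<close> members.\<close>
    have big: "x - 1 gchoose s \<le> card L"
    proof (rule ccontr)
      assume neg: "\<not> (x - 1 gchoose s \<le> card L)"
      then have M1: "x - 1 gchoose Suc s < card M"
        using part K'(2) less.prems(5) pascal1 by linarith
      moreover have "0 \<le> x - 1 gchoose Suc s" by (rule gchoose_nonneg) (use xs in auto)
      ultimately have Mne: "M \<noteq> {}" by auto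
      have "card M < card K" using part Lne fL K'(2) by (simp add: card_gt_0_iff)
      then have "x - 1 gchoose s \<le> card (shadow s M)"
        using less.hyps[of s M "x - 1"] Mu X Mne M1 xs by auto
      also have "\<dots> \<le> card L" using shM fL card_mono by auto
      finally show False using neg by simp
    qed
    have "s' + card L < s + card K" using s' part K'(2) by linarith
    then have Ls: "x - 1 gchoose s' \<le> card (shadow s' L)"
      using less.hyps[of s' L "x - 1"] Lu X Lne big xs s' by auto
    have fsL: "finite (shadow s' L)" by (rule finite_shadow[OF fL]) (use Lu finite_subset[OF _ X] in auto)
    have zL: "z \<notin> B" if "B \<in> L \<or> B \<in> shadow s' L" for B using that by (auto simp: L_def shadow_def)
    have fB: "finite B" if B: "B \<in> shadow s' L" for B
    proof -
      obtain A where "A \<in> L" "B \<subseteq> A" using B by (auto simp: shadow_def)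
      then have "B \<subseteq> X" using Lu by blast
      then show ?thesis using finite_subset[OF _ X] by simp
    qed
    \<comment> \<open>Two disjoint parts of the shadow: the sets of the link, and the shadow sets of
      the link extended by \<open>z\<close>. Pascal's rule adds their lower bounds.\<close>
    have "L \<union> insert z ` shadow s' L \<subseteq> shadow s K'"
    proof
      fix B assume "B \<in> L \<union> insert z ` shadow s' L"
      then show "B \<in> shadow s K'"
      proof
        assume "B \<in> L" then show ?thesis using Lu s' by (auto simp: L_def shadow_def)
      next
        assume "B \<in> insert z ` shadow s' L"
        then obtain C where C: "B = insert z C" "C \<in> shadow s' L" by blast
        then have "card B = s" using fB[OF C(2)] zL C s' by (auto simp: shadow_def)
        moreover obtain A where "A \<in> K'" "z \<in> A" "C \<subseteq> A - {z}" using C(2) by (auto simp: shadow_def L_def)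
        ultimately show ?thesis using C(1) by (auto simp: shadow_def)
      qed
    qed
    then have "card (L \<union> insert z ` shadow s' L) \<le> card (shadow s K')" using fs[OF K'(1)] card_mono by blast
    moreover have "card (L \<union> insert z ` shadow s' L) = card L + card (insert z ` shadow s' L)"
      by (rule card_Un_disjoint) (use fL fsL zL in auto)
    moreover have "card (insert z ` shadow s' L) = card (shadow s' L)"
    proof (rule card_image, rule inj_onI)
      fix B C assume "B \<in> shadow s' L" "C \<in> shadow s' L" "insert z B = insert z C"
      then show "B = C" using zL by (metis insert_ident)
    qed
    ultimately show ?thesis using pascal2 big Ls K'(4) by linarith
  qed
qed

section \<open>Shadow densities, and the excess of a shadow over its family\<close>

lemma prod_prefix_power_le:
  fixes u :: "nat \<Rightarrow> real"
  assumes "l \<le> r" "\<And>i. i < r \<Longrightarrow> 0 < u i" "\<And>i j. i < j \<Longrightarrow> j < r \<Longrightarrow> u j \<le> u i"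
  shows "(\<Prod>i<r. u i) ^ l \<le> (\<Prod>i<l. u i) ^ r"
  using assms
proof (induction r rule: dec_induct)
  case base
  then show ?case by simp
next
  case (step m)
  have pos: "0 \<le> (\<Prod>i<l. u i)" using step.hyps step.prems(1)
    by (intro prod_nonneg) (auto intro: less_imp_le)
  have IH: "(\<Prod>i<m. u i) ^ l \<le> (\<Prod>i<l. u i) ^ m" using step.IH step.prems by auto
  have "u m ^ l = (\<Prod>i<l. u m)" by simp
  also have "\<dots> \<le> (\<Prod>i<l. u i)"
    using step.hyps step.prems by (intro prod_mono) (auto intro: less_imp_le)
  finally have um: "u m ^ l \<le> (\<Prod>i<l. u i)" .
  have "(\<Prod>i<Suc m. u i) ^ l = (\<Prod>i<m. u i) ^ l * u m ^ l"
    by (simp add: power_mult_distrib)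
  also have "\<dots> \<le> (\<Prod>i<l. u i) ^ m * (\<Prod>i<l. u i)"
    by (rule mult_mono[OF IH um]) (use pos step.prems(1)[of m] in \<open>auto intro: less_imp_le\<close>)
  finally show ?case by (simp add: mult.commute)
qed

text \<open>Both ratios are prefix products of the factors \<open>(x - i) / (M - i)\<close>, which
  decrease in \<open>i\<close> because \<open>x <= M\<close>. The geometric mean of the first
  \<open>l\<close> of them is therefore at least that of the first \<open>r\<close>.\<close>

lemma gchoose_ratio_powr:
  fixes x :: real
  assumes "real r \<le> x" "x \<le> real M" "l \<le> r" "0 < r"
  shows "((x gchoose r) / (M choose r)) powr (l / r) \<le> (x gchoose l) / (M choose l)"
proof -
  define u where "u i = (x - real i) / (real M - real i)" for i
  have P: "(x gchoose m) / (M choose m) = (\<Prod>i<m. u i)" for m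
    by (simp add: gbinomial_prod_rev binomial_gbinomial u_def prod_dividef atLeast0LessThan)
  have pos: "0 < u i" if "i < r" for i
    using that assms by (auto simp: u_def)
  have anti: "u j \<le> u i" if "i < j" "j < r" for i j
  proof -
    have "0 \<le> (real M - x) * (real j - real i)" using that assms by simp
    then have "(x - real j) * (real M - real i) \<le> (x - real i) * (real M - real j)"
      by (simp add: algebra_simps)
    then show ?thesis using that assms unfolding u_def by (simp add: divide_simps mult.commute)
  qed
  have pr: "0 < (\<Prod>i<r. u i)" using pos by (intro prod_pos) auto
  have pl: "0 < (\<Prod>i<l. u i)" using pos assms(3) by (intro prod_pos) auto
  have "(\<Prod>i<r. u i) powr (l / r) = ((\<Prod>i<r. u i) ^ l) powr (1 / r)"
    using pr by (simp add: powr_powr flip: powr_realpow)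
  also have "\<dots> \<le> ((\<Prod>i<l. u i) ^ r) powr (1 / r)"
    by (rule powr_mono2) (use prod_prefix_power_le[of l r u] pos anti assms pr in auto)
  also have "\<dots> = (\<Prod>i<l. u i)"
    using pl assms(4) by (simp add: powr_powr flip: powr_realpow)
  finally show ?thesis unfolding P .
qed

lemma gchoose_attained:
  assumes "1 \<le> c" "c \<le> real (M choose r)" "0 < r" "r \<le> M"
  obtains x :: real where "real r \<le> x" "x \<le> real M" "x gchoose r = c"
proof -
  have "continuous_on {real r..real M} (\<lambda>x. x gchoose r)"
    unfolding gbinomial_prod_rev by (intro continuous_intros) simp
  moreover have "real r gchoose r = 1" by (metis binomial_n_n binomial_gbinomial of_nat_1)
  moreover have "real M gchoose r = real (M choose r)" by (simp add: binomial_gbinomial)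
  ultimately have "\<exists>x. real r \<le> x \<and> x \<le> real M \<and> x gchoose r = c"
    using assms by (intro IVT') auto
  then show ?thesis using that by blast
qed

lemma gchoose_diff_eq:
  fixes z :: real
  assumes "l \<le> r"
  shows "(z gchoose l) - (z gchoose r) = (z gchoose l) * (1 - (z - l gchoose (r - l)) / (r choose l))"
proof -
  have "(z gchoose r) * (r choose l) = (z gchoose l) * (z - l gchoose (r - l))"
    using gbinomial_trinomial_revision[OF assms, of z] by (simp add: binomial_gbinomial)
  moreover have "real (r choose l) \<noteq> 0" using assms by simp
  ultimately have "z gchoose r = (z gchoose l) * (z - l gchoose (r - l)) / (r choose l)"
    by (simp add: field_simps)
  then show ?thesis by (simp add: algebra_simps)
qed

text \<open>The difference is the product of the log-concave factor \<open>z gchoose l\<close> and the concave factor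
  of \<open>gchoose_diff_eq\<close>, hence it is log-concave.\<close>

lemma gchoose_diff_ge_min:
  fixes x y :: real
  assumes l: "l < r" and x: "real r \<le> x" "x \<le> y" and y: "y gchoose r < y gchoose l"
  shows "min (real (r choose l) - 1) ((y gchoose l) - (y gchoose r)) \<le> (x gchoose l) - (x gchoose r)"
proof -
  define \<rho> where "\<rho> z = (z - l gchoose (r - l)) / (r choose l)" for z :: real
  have diff: "(z gchoose l) - (z gchoose r) = (z gchoose l) * (1 - \<rho> z)" for z :: real
    unfolding \<rho>_def using gchoose_diff_eq l by simp
  have posl: "0 < z gchoose l" if "real r \<le> z" for z :: real
    unfolding gbinomial_prod_rev using that l by (intro divide_pos_pos prod_pos) auto
  have \<rho>y: "\<rho> y < 1"
    using y diff[of y] posl[of y] x by (smt (verit) mult_nonneg_nonpos)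
  have mono: "\<rho> z \<le> \<rho> y" if "real r \<le> z" "z \<le> y" for z
    unfolding \<rho>_def using that l by (intro divide_right_mono gchoose_mono) (auto simp: of_nat_diff)
  define f where "f z = (\<Sum>i<l. ln (z - real i)) + ln (1 - \<rho> z)" for z :: real
  have "concave_on {real r..y} f"
    unfolding concave_on_iff
  proof (intro conjI ballI allI impI)
    show "convex {real r..y}" by simp
    fix a b u v :: real
    assume a: "a \<in> {real r..y}" and b: "b \<in> {real r..y}" and uv: "0 \<le> u" "0 \<le> v" "u + v = 1"
    define z where "z = u *\<^sub>R a + v *\<^sub>R b"
    have lnc: "u * ln s + v * ln t \<le> ln (u * s + v * t)" if "0 < s" "0 < t" for s t
      using ln_concave that uv unfolding concave_on_iff by (auto simp del: ln_less_cancel_iff)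
    have 1: "u * ln (a - real i) + v * ln (b - real i) \<le> ln (z - real i)" if "i < l" for i
    proof -
      have "u * (a - real i) + v * (b - real i) = z - real i * (u + v)"
        by (simp add: z_def algebra_simps)
      then show ?thesis using lnc[of "a - real i" "b - real i"] that a b l uv by simp
    qed
    have "\<rho> z \<le> u * \<rho> a + v * \<rho> b"
    proof -
      have "convex_on {real (r - l) - 1..} (\<lambda>x. x gchoose (r - l))" by (rule convex_gchoose)
      then have "u *\<^sub>R (a - l) + v *\<^sub>R (b - l) gchoose (r - l)
          \<le> u * (a - l gchoose (r - l)) + v * (b - l gchoose (r - l))"
        unfolding convex_on_def using a b uv l by (auto simp: of_nat_diff)
      moreover have "u *\<^sub>R (a - l) + v *\<^sub>R (b - l) = z - real l * (u + v)"
        by (simp add: z_def algebra_simps)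
      ultimately have "z - l gchoose (r - l) \<le> u * (a - l gchoose (r - l)) + v * (b - l gchoose (r - l))"
        using uv by simp
      then have "\<rho> z \<le> (u * (a - l gchoose (r - l)) + v * (b - l gchoose (r - l))) / (r choose l)"
        unfolding \<rho>_def by (intro divide_right_mono) auto
      then show ?thesis by (simp add: \<rho>_def add_divide_distrib)
    qed
    then have le: "u * (1 - \<rho> a) + v * (1 - \<rho> b) \<le> 1 - \<rho> z" using uv by (simp add: algebra_simps)
    have pa: "0 < 1 - \<rho> a" "0 < 1 - \<rho> b" using mono[of a] mono[of b] a b \<rho>y by auto
    have "0 < u * (1 - \<rho> a) + v * (1 - \<rho> b)"
      using pa uv by (smt (verit) mult_pos_pos split_mult_pos_le)
    then have 2: "u * ln (1 - \<rho> a) + v * ln (1 - \<rho> b) \<le> ln (1 - \<rho> z)"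
      using lnc[OF pa] le by (smt (verit) ln_le_cancel_iff)
    have "u * (\<Sum>i<l. ln (a - real i)) + v * (\<Sum>i<l. ln (b - real i)) \<le> (\<Sum>i<l. ln (z - real i))"
      unfolding sum_distrib_left sum.distrib[symmetric] using 1 by (intro sum_mono) auto
    then show "u * f a + v * f b \<le> f (u *\<^sub>R a + v *\<^sub>R b)"
      unfolding f_def z_def[symmetric] using 2 by (simp add: algebra_simps)
  qed
  \<comment> \<open>Concavity leaves only the two end points. At the left one, \<open>x = r\<close>,
    the difference is \<open>(r choose l) - 1\<close>, the excess produced by a single
    \<open>r\<close>-set.\<close>
  then have fx: "min (f r) (f y) \<le> f x" by (rule concave_on_ge_min) (use x in auto)
  have g: "(z gchoose l) - (z gchoose r) = exp (f z) / fact l" if z: "real r \<le> z" "z \<le> y" for z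
  proof -
    have "exp (\<Sum>i<l. ln (z - real i)) = (\<Prod>i<l. z - real i)"
      unfolding exp_sum[OF finite_lessThan] using z l by (intro prod.cong) auto
    then have "exp (\<Sum>i<l. ln (z - real i)) = (z gchoose l) * fact l"
      by (simp add: gbinomial_prod_rev atLeast0LessThan)
    moreover have "0 < 1 - \<rho> z" using mono[OF z] \<rho>y by simp
    ultimately show ?thesis unfolding diff f_def exp_add by simp
  qed
  have "real (r choose l) - 1 = exp (f r) / fact l"
    using g[of "real r"] x by (metis binomial_gbinomial binomial_n_n of_nat_1 order_refl order_trans)
  moreover have "min (exp (f r) / fact l) (exp (f y) / fact l) \<le> exp (f x) / fact l"
  proof -
    have "f r \<le> f x \<or> f y \<le> f x" using fx by (auto simp: min_def split: if_splits)
    then have "exp (f r) / fact l \<le> exp (f x) / fact l \<or> exp (f y) / fact l \<le> exp (f x) / fact l"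
      by (auto intro: divide_right_mono)
    then show ?thesis by (meson min.coboundedI1 min.coboundedI2)
  qed
  ultimately show ?thesis using g[of y] g[of x] x by simp
qed

text \<open>The same \<open>x\<close> works at every level, since the conclusion of the one-step
  theorem is its hypothesis one level lower.\<close>

lemma shadow_lower_bound:
  assumes "K \<subseteq> {A. A \<subseteq> X \<and> card A = r}" "finite X" "K \<noteq> {}"
    and "real r \<le> x" "x gchoose r \<le> card K" "l \<le> r"
  shows "x gchoose l \<le> card (shadow l K)"
  using assms(6)
proof (induction l rule: inc_induct)
  case base
  have "K \<subseteq> shadow r K" using assms(1) by (auto simp: shadow_def)
  moreover have "finite (shadow r K)"
    by (rule finite_shadow[OF finite_uniform[OF assms(2,1)]])
      (use assms(1) finite_subset[OF _ assms(2)] in auto)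
  ultimately have "card K \<le> card (shadow r K)" by (rule card_mono[rotated])
  then show ?case using assms(5) by linarith
next
  case (step s)
  let ?L = "shadow (Suc s) K"
  have u: "?L \<subseteq> {A. A \<subseteq> X \<and> card A = Suc s}" using assms(1) by (auto simp: shadow_def)
  have "0 < x gchoose Suc s"
    unfolding gbinomial_prod_rev using step.hyps assms(4) by (intro divide_pos_pos prod_pos) auto
  then have "?L \<noteq> {}" using step.IH by auto
  then have "x gchoose s \<le> card (shadow s ?L)"
    using kruskal_katona_lovasz[OF u assms(2)] step.IH step.hyps assms(4) by simp
  also have "shadow s ?L \<subseteq> shadow s K" by (auto simp: shadow_def)
  then have "real (card (shadow s ?L)) \<le> card (shadow s K)"
    by (intro of_nat_mono card_mono)
      (auto intro!: finite_shadow finite_uniform[OF assms(2,1)] dest: subsetD[OF assms(1)]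
        intro: finite_subset[OF _ assms(2)])
  finally show ?case .
qed

text \<open>\<open>M\<close> is a reference size that may differ from the size of \<open>X\<close>.
  The choice \<open>M = l + r\<close> makes the binomials at levels \<open>l\<close> and
  \<open>r\<close> equal, so that densities compare directly with sizes.\<close>

lemma density_shadow:
  assumes K: "K \<subseteq> {A. A \<subseteq> X \<and> card A = r}" "finite X"
    and "card K \<le> M choose r" "r \<le> M" "l \<le> r" "0 < r" "0 < l"
  shows "(M choose l) * (card K / (M choose r)) powr (l / r) \<le> card (shadow l K)"
proof (cases "K = {}")
  case True then show ?thesis by simp
next
  case False
  then have "1 \<le> card K" using finite_uniform[OF K(2,1)] by (simp add: Suc_leI card_gt_0_iff)
  then obtain x where x: "real r \<le> x" "x \<le> real M" "x gchoose r = card K"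
    using gchoose_attained[of "real (card K)" M r] assms by auto
  have "(card K / (M choose r)) powr (l / r) \<le> (x gchoose l) / (M choose l)"
    using gchoose_ratio_powr[OF x(1,2) assms(5,6)] x(3) by simp
  then have "(M choose l) * (card K / (M choose r)) powr (l / r) \<le> x gchoose l"
    using assms by (simp add: field_simps)
  also have "\<dots> \<le> card (shadow l K)"
    by (rule shadow_lower_bound[OF K False x(1) _ assms(5)]) (simp add: x)
  finally show ?thesis .
qed

text \<open>A density is at most 1, so raising it to the power \<open>l / r <= 1\<close> does not
  decrease it. For \<open>M\<close> the size of \<open>X\<close> this is the normalised matching
  property; smaller \<open>M\<close> strengthens it for small families.\<close>

lemma shadow_normalized:
  assumes K: "K \<subseteq> {A. A \<subseteq> X \<and> card A = r}" "finite X"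
    and "card K \<le> M choose r" "r \<le> M" "l \<le> r" "0 < r" "0 < l"
  shows "(M choose l) * (card K / (M choose r)) \<le> card (shadow l K)"
proof -
  let ?\<gamma> = "card K / (M choose r)"
  have "?\<gamma> \<le> ?\<gamma> powr (l / r)"
  proof (cases "?\<gamma> = 0")
    case False
    then have "0 < ?\<gamma>" by (smt (verit) divide_nonneg_nonneg of_nat_0_le_iff)
    moreover have "?\<gamma> \<le> 1" using assms by (simp add: divide_le_eq_1)
    ultimately have "?\<gamma> powr 1 \<le> ?\<gamma> powr (l / r)" using assms by (intro powr_mono') auto
    then show ?thesis using \<open>0 < ?\<gamma>\<close> by simp
  next
    case True
    then show ?thesis by (simp only: powr_zero_eq_one powr_0)
  qed
  then have "(M choose l) * ?\<gamma> \<le> (M choose l) * ?\<gamma> powr (l / r)" by (intro mult_left_mono) auto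
  also have "\<dots> \<le> card (shadow l K)" by (rule density_shadow[OF assms])
  finally show ?thesis .
qed

text \<open>The hypothesis on \<open>\<alpha>\<close> is what \<open>\<alpha> powr (l / r) - \<alpha> \<ge> \<alpha> * (1 - l / r) * (1 - \<alpha>)\<close> needs to make
  the difference large at the right end point of the range.\<close>

lemma shadow_excess:
  fixes \<alpha> :: real
  assumes K: "K \<subseteq> {A. A \<subseteq> X \<and> card A = r}" "finite X" "K \<noteq> {}"
    and lr: "0 < l" "l < r" and \<alpha>: "0 < \<alpha>" "\<alpha> < 1" "card K \<le> \<alpha> * (l + r choose l)"
    and E: "real (r choose l) \<le> \<alpha> * (1 - \<alpha>) * (1 - l / r) * (l + r choose l)"
  shows "real (card K) + real (r choose l) - 1 \<le> card (shadow l K)"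
proof -
  let ?R = "real (l + r choose l)"
  have R: "?R = real (l + r choose r)" by (metis add.commute binomial_symmetric le_add1 add_diff_cancel_left')
  have cK: "1 \<le> card K" using K finite_uniform[OF K(2,1)] by (simp add: Suc_leI card_gt_0_iff)
  have Rpos: "0 < ?R" by simp
  have "\<alpha> * ?R \<le> ?R" using \<alpha> by simp
  \<comment> \<open>\<open>y\<close> is the right end of the range, where the family has size
    \<open>\<alpha> * ?R\<close>. The exponential estimate below shows that the shadow bound exceeds
    this size by at least \<open>r choose l\<close>.\<close>
  then obtain y where y: "real r \<le> y" "y \<le> real (l + r)" "y gchoose r = \<alpha> * ?R"
    using gchoose_attained[of "\<alpha> * ?R" "l + r" r] cK \<alpha> lr R by auto
  have "\<alpha> * (1 + (1 - l / r) * (1 - \<alpha>)) \<le> \<alpha> powr (l / r)"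
  proof -
    have "(1 - l / r) * (1 - \<alpha>) \<le> (1 - l / r) * (- ln \<alpha>)"
      using ln_le_minus_one[OF \<alpha>(1)] lr by (intro mult_left_mono) auto
    also have "1 + \<dots> \<le> exp ((1 - l / r) * (- ln \<alpha>))" by (rule exp_ge_add_one_self)
    finally have "1 + (1 - l / r) * (1 - \<alpha>) \<le> exp ((1 - l / r) * (- ln \<alpha>))" by simp
    then have "\<alpha> * (1 + (1 - l / r) * (1 - \<alpha>)) \<le> exp (ln \<alpha>) * exp ((1 - l / r) * (- ln \<alpha>))"
      using \<alpha> by simp
    also have "\<dots> = exp (l / r * ln \<alpha>)" unfolding exp_add[symmetric] by (simp add: algebra_simps)
    finally show ?thesis using \<alpha> by (simp add: powr_def)
  qed
  then have "?R * (\<alpha> * (1 + (1 - l / r) * (1 - \<alpha>))) \<le> ?R * \<alpha> powr (l / r)"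
    by (intro mult_left_mono) auto
  also have "\<alpha> powr (l / r) \<le> (y gchoose l) / ?R"
    using gchoose_ratio_powr[OF y(1,2), of l] y(3) lr R by simp
  then have "?R * \<alpha> powr (l / r) \<le> y gchoose l" using Rpos by (simp add: field_simps)
  finally have y2: "real (r choose l) \<le> (y gchoose l) - (y gchoose r)"
    using E y(3) by (simp add: algebra_simps)
  have "0 < r choose l" using lr by simp
  then have y3: "y gchoose r < y gchoose l" using y2 by linarith
  have "card K \<le> l + r choose r" using \<alpha>(3) \<open>\<alpha> * ?R \<le> ?R\<close> R by linarith
  then obtain x where x: "real r \<le> x" "x gchoose r = card K"
    using gchoose_attained[of "real (card K)" "l + r" r] cK lr by auto
  have "x \<le> y"
  proof (rule ccontr)
    assume "\<not> x \<le> y"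
    have "y gchoose r < x gchoose r"
      unfolding gbinomial_prod_rev using \<open>\<not> x \<le> y\<close> y lr
      by (intro divide_strict_right_mono prod_mono_strict) auto
    then show False using x(2) y(3) \<alpha>(3) by simp
  qed
  then have "real (r choose l) - 1 \<le> (x gchoose l) - (x gchoose r)"
    using gchoose_diff_ge_min[OF lr(2) x(1) _ y3] y2 by simp
  moreover have "x gchoose l \<le> card (shadow l K)"
    by (rule shadow_lower_bound[OF K x(1)]) (use x lr in auto)
  ultimately show ?thesis using x(2) by linarith
qed

section \<open>Cross-intersecting families\<close>

abbreviation uniform :: "'a set \<Rightarrow> nat \<Rightarrow> 'a set set" where
  "uniform X k \<equiv> {A. A \<subseteq> X \<and> card A = k}"

lemma cross_intersecting_sym: "cross_intersecting A B \<Longrightarrow> cross_intersecting B A"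
  unfolding cross_intersecting_def by blast

lemma cross_intersecting_mono:
  "cross_intersecting A B \<Longrightarrow> A' \<subseteq> A \<Longrightarrow> B' \<subseteq> B \<Longrightarrow> cross_intersecting A' B'"
  unfolding cross_intersecting_def by blast

lemma card_uniform: "finite X \<Longrightarrow> card (uniform X k) = card X choose k"
  by (simp add: n_subsets)

lemma complements_uniform:
  assumes "B \<subseteq> uniform X k" "finite X"
  shows "(\<lambda>S. X - S) ` B \<subseteq> uniform X (card X - k)" "card ((\<lambda>S. X - S) ` B) = card B"
proof -
  show "(\<lambda>S. X - S) ` B \<subseteq> uniform X (card X - k)"
  proof
    fix T assume "T \<in> (\<lambda>S. X - S) ` B"
    then obtain S where S: "S \<in> B" "T = X - S" by blast
    then have "S \<subseteq> X" "card S = k" using assms by auto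
    then show "T \<in> uniform X (card X - k)"
      using S(2) by (auto simp: card_Diff_subset finite_subset[OF _ assms(2)])
  qed
  show "card ((\<lambda>S. X - S) ` B) = card B"
  proof (rule card_image, rule inj_onI)
    fix S T assume "S \<in> B" "T \<in> B" "X - S = X - T"
    then show "S = T" using assms(1) double_diff[of S X X] double_diff[of T X X] by auto
  qed
qed

text \<open>An \<open>l\<close>-subset of \<open>X\<close> misses a member \<open>S\<close> of
  \<open>B\<close> exactly when it lies in \<open>X - S\<close>, so the shadow of the complements
  consists of the \<open>l\<close>-sets forbidden for \<open>A\<close>.\<close>

lemma cross_shadow:
  assumes A: "A \<subseteq> uniform X l" and B: "B \<subseteq> uniform X k" and X: "finite X"
    and c: "cross_intersecting A B"
  shows "card A + card (shadow l ((\<lambda>S. X - S) ` B)) \<le> card X choose l"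
proof -
  let ?S = "shadow l ((\<lambda>S. X - S) ` B)"
  have sub: "?S \<subseteq> uniform X l" by (auto simp: shadow_def)
  have "A \<inter> ?S = {}" using c unfolding cross_intersecting_def shadow_def by blast
  then have "card A + card ?S = card (A \<union> ?S)"
    using finite_uniform[OF X A] finite_uniform[OF X sub] by (simp add: card_Un_disjoint)
  also have "\<dots> \<le> card (uniform X l)"
    using A sub finite_uniform[OF X, of "uniform X l" l] by (intro card_mono) auto
  finally show ?thesis using card_uniform[OF X] by simp
qed

context
  fixes A B :: "'a set set" and X :: "'a set" and l k r :: nat
  assumes A: "A \<subseteq> uniform X l" and B: "B \<subseteq> uniform X k" and X: "finite X"
    and c: "cross_intersecting A B" and r: "r = card X - k"
begin

private lemma complements:
  "(\<lambda>S. X - S) ` B \<subseteq> uniform X r" "card ((\<lambda>S. X - S) ` B) = card B"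
  using complements_uniform[OF B X] r by auto

text \<open>The source of the Hilton--Milner number: one set in \<open>B\<close> excludes
  \<open>r choose l\<close> sets from \<open>A\<close>, and in the given range every larger
  \<open>B\<close> excludes at least as many additional sets as it adds.\<close>

lemma cross_excess_bound:
  fixes \<alpha> :: real
  assumes "B \<noteq> {}" "0 < l" "l < r" "0 < \<alpha>" "\<alpha> < 1" "card B \<le> \<alpha> * (l + r choose l)"
    and "real (r choose l) \<le> \<alpha> * (1 - \<alpha>) * (1 - l / r) * (l + r choose l)"
  shows "real (card A) + real (card B) \<le> real (card X choose l) - real (r choose l) + 1"
proof -
  have "real (card B) + real (r choose l) - 1 \<le> card (shadow l ((\<lambda>S. X - S) ` B))"
    using shadow_excess[OF complements(1) X] complements(2) assms by auto
  then show ?thesis using cross_shadow[OF A B X c] by linarith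
qed

text \<open>With reference size \<open>l + r\<close> the binomials at both levels coincide, so the
  shadow of the complements is at least as large as \<open>B\<close>.\<close>

lemma cross_small_bound:
  assumes "0 < l" "l \<le> r" "card B \<le> l + r choose l"
  shows "card A + card B \<le> card X choose l"
proof -
  have R: "l + r choose r = l + r choose l"
    by (metis add.commute binomial_symmetric le_add1 add_diff_cancel_left')
  have "(l + r choose l) * (card B / (l + r choose r)) \<le> card (shadow l ((\<lambda>S. X - S) ` B))"
    using shadow_normalized[OF complements(1) X, of "l + r" l] complements(2) assms R by simp
  then show ?thesis using cross_shadow[OF A B X c] R by simp
qed

lemma cross_large_bound:
  assumes "l \<le> r" "r \<le> M" "M choose r \<le> card B"
  shows "card A + (M choose l) \<le> card X choose l"
proof -
  have "0 < M choose r" using assms(2) by simp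
  then have "B \<noteq> {}" using assms(3) by auto
  moreover have "real M gchoose r \<le> card B" using assms(3) by (simp flip: binomial_gbinomial)
  ultimately have "real M gchoose l \<le> card (shadow l ((\<lambda>S. X - S) ` B))"
    using shadow_lower_bound[OF complements(1) X, of "real M" l] complements(2) assms by auto
  then have "M choose l \<le> card (shadow l ((\<lambda>S. X - S) ` B))" by (simp flip: binomial_gbinomial)
  then show ?thesis using cross_shadow[OF A B X c] by linarith
qed

lemma cross_density_bound:
  assumes "0 < l" "l \<le> r" "r \<le> M" "card B \<le> M choose r"
  shows "card A + (M choose l) * (card B / (M choose r)) powr (l / r) \<le> card X choose l"
  using density_shadow[OF complements(1) X, of M l] complements(2) assms cross_shadow[OF A B X c]
  by simp

end

section \<open>Calculus for the product of two cross-intersecting families\<close>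

lemma weighted_young:
  fixes \<gamma> z e :: real
  assumes "0 < \<gamma>" "0 < z" "0 < e"
  shows "(1 + e) * \<gamma> * z powr (e / (1 + e)) \<le> \<gamma> powr (1 + e) + e * z"
proof -
  have "(\<gamma> powr (1 + e)) powr (1 / (1 + e)) * z powr (e / (1 + e))
      \<le> 1 / (1 + e) * \<gamma> powr (1 + e) + e / (1 + e) * z"
    by (rule Youngs_inequality_0) (use assms in \<open>auto simp: field_simps\<close>)
  also have "(\<gamma> powr (1 + e)) powr (1 / (1 + e)) = \<gamma>" using assms by (simp add: powr_powr)
  finally have "(1 + e) * (\<gamma> * z powr (e / (1 + e))) \<le> (1 + e) * (1 / (1 + e) * \<gamma> powr (1 + e) + e / (1 + e) * z)"
    using assms by (intro mult_left_mono) auto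
  also have "\<dots> = \<gamma> powr (1 + e) + e * z" using assms by (simp add: distrib_left)
  finally show ?thesis by (simp add: mult.assoc)
qed

text \<open>The left side is largest where \<open>\<gamma> powr e = y\<close>, and its value there
  is \<open>e * z\<close>, so Young's inequality loses nothing. The loss lies in
  \<open>ln y <= y - 1\<close> and \<open>exp (1 / w) >= 1 + 1 / w\<close>, which make the bound
  rational.\<close>

lemma product_calculus:
  fixes \<gamma> e q w :: real
  assumes "0 < \<gamma>" "0 < e" "0 < q" and w: "0 < w" "(e - q) / e = 1 / w"
  shows "\<gamma> * (1 + q - \<gamma> powr e) \<le> e * (w / (w + 1))"
proof -
  define y where "y = (1 + q) / (1 + e)"
  define z where "z = y powr ((1 + e) / e)"
  have y: "0 < y" using assms by (simp add: y_def)
  have z: "0 < z" using y by (simp add: z_def)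
  have "z powr (e / (1 + e)) = y" using y assms by (simp add: z_def powr_powr)
  then have "(1 + e) * \<gamma> * y \<le> \<gamma> powr (1 + e) + e * z"
    using weighted_young[of \<gamma> z e] assms z by simp
  moreover have "(1 + e) * \<gamma> * y = (1 + q) * \<gamma>" using assms by (simp add: y_def)
  moreover have "\<gamma> powr (1 + e) = \<gamma> * \<gamma> powr e" using assms by (simp add: powr_add)
  ultimately have 1: "\<gamma> * (1 + q - \<gamma> powr e) \<le> e * z" by (simp add: algebra_simps)
  have "(1 + e) / e * ln y \<le> (1 + e) / e * (y - 1)"
    using ln_le_minus_one[OF y] assms by (intro mult_left_mono) auto
  also have "\<dots> = - ((e - q) / e)"
  proof -
    have "y - 1 = (q - e) / (1 + e)" using assms by (simp add: y_def field_simps)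
    then show ?thesis using assms by (simp add: divide_simps mult.commute)
  qed
  also have "\<dots> = - (1 / w)" using w(2) by simp
  finally have "z \<le> exp (- (1 / w))" using y by (simp add: z_def powr_def)
  also have "\<dots> = 1 / exp (1 / w)" by (simp add: exp_minus inverse_eq_divide)
  also have "\<dots> \<le> 1 / (1 + 1 / w)"
    using exp_ge_add_one_self[of "1 / w"] w by (intro divide_left_mono mult_pos_pos) (auto simp: add_pos_pos)
  also have "\<dots> = w / (w + 1)" using w by (simp add: field_simps)
  finally have "e * z \<le> e * (w / (w + 1))" using assms by (intro mult_left_mono) auto
  then show ?thesis using 1 by linarith
qed

text \<open>The left side is concave in \<open>\<gamma>\<close> with slope \<open>R - B * e\<close>
  at \<open>\<gamma> = 1\<close>. The last hypothesis makes this slope nonnegative, so the value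
  \<open>R\<close> at 1 is the maximum on the interval.\<close>

lemma bernoulli_product:
  fixes \<gamma> e B R :: real
  assumes "0 \<le> \<gamma>" "\<gamma> \<le> 1" "0 < e" "0 \<le> B" "B * e \<le> R"
  shows "\<gamma> * (R + B - B * \<gamma> powr e) \<le> R"
proof (cases "\<gamma> = 0")
  case True
  have "0 \<le> B * e" using assms by simp
  then have "0 \<le> R" using assms by linarith
  then show ?thesis using True by simp
next
  case False
  have "(1 + e) * \<gamma> \<le> \<gamma> powr (1 + e) + e"
    using weighted_young[of \<gamma> 1 e] assms False by simp
  also have "\<gamma> powr (1 + e) = \<gamma> * \<gamma> powr e" using False assms by (simp add: powr_add)
  finally have "B * ((1 + e) * \<gamma> - e) \<le> B * (\<gamma> * \<gamma> powr e)" using assms by (intro mult_left_mono) auto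
  moreover have "(1 - \<gamma>) * (R - B * e) \<ge> 0" using assms by simp
  ultimately show ?thesis by (simp add: algebra_simps)
qed

lemma choose_Suc_ratio: "Suc j * (N choose Suc j) = (N - j) * (N choose j)"
  by (simp only: binomial_absorption binomial_absorb_comp)

lemma choose_Suc_ratio_real:
  assumes "j \<le> N"
  shows "(real j + 1) * real (N choose Suc j) = real (N - j) * real (N choose j)"
proof -
  have "real (Suc j * (N choose Suc j)) = real ((N - j) * (N choose j))"
    by (simp only: choose_Suc_ratio)
  then show ?thesis unfolding of_nat_mult of_nat_Suc by (simp only: add.commute)
qed

text \<open>The sharp bound, attained by two stars, has \<open>r + 1\<close> in place of \<open>r * (r + 2) / (r + 1)\<close>; the
  density bound for small \<open>B\<close> does not quite reach it.\<close>

lemma cross_product_bound: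
  assumes A: "A \<subseteq> uniform X l" and B: "B \<subseteq> uniform X (Suc l)" and X: "finite X"
    and c: "cross_intersecting A B" and card_X: "card X = Suc (l + r)" and lr: "0 < l" "l < r"
  shows "real (card A) * real (card B)
    \<le> (real (l + r choose l))\<^sup>2 * (real l * (real r + 1) / (real r * (real r + 2)))"
proof -
  define R where "R = real (l + r choose l)"
  have Rpos: "0 < R" by (simp add: R_def)
  have rX: "r = card X - Suc l" using card_X by simp
  have Rr: "l + r choose r = l + r choose l"
    by (metis add.commute binomial_symmetric le_add1 add_diff_cancel_left')
  obtain l' where l': "l = Suc l'" using lr by (cases l) auto
  define R' where "R' = real (l + r choose l')"
  define q where "q = real l / (real r + 1)"
  have "real l * R = (real r + 1) * R'"
    using choose_Suc_ratio_real[of l' "l + r"] l' unfolding R_def R'_def by (simp add: add_ac)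
  then have R'q: "R' = q * R" by (simp add: q_def field_simps)
  have up: "real (card X choose l) = R + R'"
    unfolding card_X R_def R'_def l' by simp
  have r0: "0 < real r" using lr by simp
  have q_le: "q \<le> real l * (real r + 1) / (real r * (real r + 2))"
  proof -
    have "real l * (real r * (real r + 2)) \<le> real l * ((real r + 1) * (real r + 1))"
      by (intro mult_left_mono) (auto simp: algebra_simps)
    then show ?thesis unfolding q_def using r0 by (simp add: divide_simps mult_ac)
  qed
  show ?thesis
  proof (cases "B = {}")
    case True
    then show ?thesis by simp
  next
    case Bne: False
    show ?thesis
    proof (cases "card B \<le> l + r choose l")
      \<comment> \<open>For small \<open>B\<close> its density \<open>\<gamma>\<close> bounds
        \<open>A\<close>. The calculus applies with exponent \<open>l / r\<close> and
        \<open>q = l / (r + 1)\<close>, whose relative gap is \<open>1 / (r + 1)\<close>.\<close>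
      case True
      define \<gamma> where "\<gamma> = card B / R"
      have "0 < card B" using Bne finite_uniform[OF X B] by (simp add: card_gt_0_iff)
      then have \<gamma>: "0 < \<gamma>" using Rpos by (simp add: \<gamma>_def)
      have "card A + R * \<gamma> powr (l / r) \<le> card X choose l"
        using cross_density_bound[OF A B X c rX, of "l + r"] lr True Rr by (simp add: R_def \<gamma>_def)
      then have A_le: "card A \<le> R * (1 + q - \<gamma> powr (l / r))"
        using up R'q by (simp add: algebra_simps)
      have "(real l / r - q) / (real l / r) = 1 / (real r + 1)"
      proof -
        have "(real l / r - q) / (real l / r) = 1 - q / (real l / r)"
          by (subst diff_divide_distrib, subst divide_self) (use lr in auto)
        also have "q / (real l / r) = r / (real r + 1)" using lr by (simp add: q_def)
        finally show ?thesis by (simp add: field_simps)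
      qed
      then have calc: "\<gamma> * (1 + q - \<gamma> powr (l / r)) \<le> l / r * ((real r + 1) / (real r + 1 + 1))"
        using product_calculus[of \<gamma> "l / r" q "real r + 1"] \<gamma> lr by (simp add: q_def)
      have "real (card A) * card B \<le> R * (1 + q - \<gamma> powr (l / r)) * (R * \<gamma>)"
        using A_le Rpos by (intro mult_mono) (auto simp: \<gamma>_def)
      also have "\<dots> = R\<^sup>2 * (\<gamma> * (1 + q - \<gamma> powr (l / r)))" by (simp add: power2_eq_square)
      also have "\<dots> \<le> R\<^sup>2 * (l / r * ((real r + 1) / (real r + 1 + 1)))"
        using calc by (intro mult_left_mono) auto
      also have "\<dots> = R\<^sup>2 * (real l * (real r + 1) / (real r * (real r + 2)))" by simp
      finally show ?thesis by (simp add: R_def)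
    next
      \<comment> \<open>For large \<open>B\<close>, \<open>A\<close> has at most \<open>R'\<close>
        members and the roles are exchanged: the complements of \<open>A\<close> have
        \<open>r + 1\<close> elements, and their shadow at level \<open>l + 1\<close> bounds
        \<open>B\<close>. This side reaches the sharp factor \<open>q\<close>.\<close>
      case False
      have "card A + (l + r choose l) \<le> card X choose l"
        by (rule cross_large_bound[OF A B X c rX]) (use False lr Rr in auto)
      then have A_le: "card A \<le> l + r choose l'" using up unfolding R_def R'_def by linarith
      define BB where "BB = real (l + r choose Suc l)"
      have BB: "(real l + 1) * BB = r * R"
        using choose_Suc_ratio_real[of l "l + r"] unfolding R_def BB_def by simp
      have up2: "real (card X choose Suc l) = R + BB" unfolding card_X R_def BB_def by simp
      have R'r: "l + r choose Suc r = l + r choose l'"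
        using binomial_symmetric[of "Suc r" "l + r"] l' by simp
      have R'pos: "0 < R'" unfolding R'_def l' by simp
      define \<gamma> where "\<gamma> = card A / R'"
      have \<gamma>: "0 \<le> \<gamma>" "\<gamma> \<le> 1" using A_le R'pos by (auto simp: \<gamma>_def R'_def)
      have "card B + BB * \<gamma> powr (Suc l / Suc r) \<le> card X choose Suc l"
        using cross_density_bound[OF B A X cross_intersecting_sym[OF c], of "Suc r" "l + r"]
          lr A_le R'r card_X by (simp add: BB_def \<gamma>_def R'_def)
      then have B_le: "card B \<le> R + BB - BB * \<gamma> powr (Suc l / Suc r)" using up2 by simp
      have "BB * (Suc l / Suc r) = R * (r / (real r + 1))" using BB by (simp add: field_simps)
      also have "\<dots> \<le> R * 1" using Rpos by (intro mult_left_mono) auto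
      finally have "\<gamma> * (R + BB - BB * \<gamma> powr (Suc l / Suc r)) \<le> R"
        using bernoulli_product[OF \<gamma>, of "Suc l / Suc r" BB R] by (simp add: BB_def)
      then have "\<gamma> * card B \<le> R" using B_le \<gamma>(1) by (meson mult_left_mono order_trans)
      then have "R' * (\<gamma> * card B) \<le> R' * R" using R'pos by simp
      moreover have "R' * (\<gamma> * card B) = real (card A) * card B" using R'pos by (simp add: \<gamma>_def)
      moreover have "R' * R = R\<^sup>2 * q" by (simp add: R'q power2_eq_square)
      ultimately have "real (card A) * card B \<le> R\<^sup>2 * q" by simp
      also have "\<dots> \<le> R\<^sup>2 * (real l * (real r + 1) / (real r * (real r + 2)))"
        using q_le by (intro mult_left_mono) auto
      finally show ?thesis by (simp add: R_def)
    qed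
  qed
qed

section \<open>Links, deletions and the inequalities that combine their sizes\<close>

definition link :: "'a set set \<Rightarrow> 'a \<Rightarrow> 'a set set" where
  "link F i = (\<lambda>A. A - {i}) ` {A \<in> F. i \<in> A}"

definition deletion :: "'a set set \<Rightarrow> 'a \<Rightarrow> 'a set set" where
  "deletion F i = {A \<in> F. i \<notin> A}"

lemma card_link: "card (link F i) = card {A \<in> F. i \<in> A}"
  unfolding link_def by (rule card_image) (auto simp: inj_on_def)

lemma card_link_deletion:
  assumes "finite F"
  shows "card F = card (link F i) + card (deletion F i)"
proof -
  have "F = {A \<in> F. i \<in> A} \<union> deletion F i" by (auto simp: deletion_def)
  moreover have "card ({A \<in> F. i \<in> A} \<union> deletion F i) = card {A \<in> F. i \<in> A} + card (deletion F i)"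
    by (rule card_Un_disjoint) (use assms in \<open>auto simp: deletion_def\<close>)
  ultimately show ?thesis by (simp add: card_link)
qed

lemma link_uniform:
  assumes "F \<subseteq> uniform X (Suc l)"
  shows "link F i \<subseteq> uniform (X - {i}) l"
  using assms by (auto simp: link_def card_Diff_singleton)

lemma deletion_uniform: "F \<subseteq> uniform X k \<Longrightarrow> deletion F i \<subseteq> uniform (X - {i}) k"
  by (auto simp: deletion_def)

lemma cross_link_deletion:
  "cross_intersecting F G \<Longrightarrow> cross_intersecting (link F i) (deletion G i)"
  unfolding cross_intersecting_def link_def deletion_def by blast

text \<open>A member \<open>insert j B\<close> of the deletion is shifted to
  \<open>insert i B\<close>. Compression thus turns a lower bound on the shadow of the deletion into
  one on the link.\<close>

lemma shadow_deletion_subset_link: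
  assumes F: "F \<subseteq> uniform X (Suc l)" "finite X" and sh: "\<And>j. j \<in> X \<Longrightarrow> shift i j F = F"
  shows "shadow l (deletion F i) \<subseteq> link F i"
proof
  fix B assume "B \<in> shadow l (deletion F i)"
  then obtain A where A: "A \<in> F" "i \<notin> A" "B \<subseteq> A" "card B = l" by (auto simp: shadow_def deletion_def)
  have fA: "finite A" "card A = Suc l" "A \<subseteq> X" using A(1) F finite_subset[OF _ F(2)] by auto
  then have "card (A - B) = 1" using A by (simp add: card_Diff_subset finite_subset[of B A])
  then obtain j where j: "A - B = {j}" using card_1_singletonE by blast
  have "shift_set i j A = insert i B" using A j by (auto simp: shift_set_def)
  then have "insert i B \<in> shift i j F" using shift_set_in_shift[OF A(1), of i j] by simp
  then have "insert i B \<in> F" using sh[of j] j fA by blast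
  then show "B \<in> link F i" unfolding link_def using A by (auto intro!: image_eqI[of _ _ "insert i B"])
qed

text \<open>Expanding the product and using \<open>f * g <= Q^2 / w\<close> for
  \<open>w = a * b\<close> leaves \<open>Q^2 / w + 2 * Q + w\<close>. This is convex in
  \<open>w\<close> and takes the same value at \<open>lam * Q\<close> and \<open>Q / lam\<close>,
  which is the bound.\<close>

lemma product_bound_balanced:
  fixes f a g b Q lam :: real
  assumes "0 \<le> f" "0 \<le> a" "0 \<le> g" "0 \<le> b" "f * b \<le> Q" "g * a \<le> Q"
    and "0 < Q" "0 < lam" "lam * Q \<le> a * b" "lam * (a * b) \<le> Q"
  shows "(f + a) * (g + b) \<le> Q * (1 + lam)\<^sup>2 / lam"
proof -
  define w where "w = a * b"
  have "0 < lam * Q" using assms(7,8) by simp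
  then have w: "0 < w" using assms(9) unfolding w_def by linarith
  have "(f * b) * (g * a) \<le> Q * Q" using assms by (intro mult_mono) auto
  then have "f * g * w \<le> Q * Q" by (simp add: w_def mult_ac)
  then have 1: "f * g \<le> Q * Q / w" using w by (simp add: pos_le_divide_eq)
  have "(w - lam * Q) * (Q - lam * w) \<ge> 0" using assms by (simp add: w_def)
  then have "lam * (Q * Q + w * w) \<le> Q * w * (1 + lam * lam)"
    by (simp add: algebra_simps)
  then have 2: "Q * Q / w + w \<le> Q * (1 + lam * lam) / lam"
    using w assms(8) by (simp add: divide_simps algebra_simps)
  have "(f + a) * (g + b) = f * g + f * b + g * a + w" by (simp add: w_def algebra_simps)
  also have "\<dots> \<le> Q * (1 + lam * lam) / lam + 2 * Q" using 1 2 assms by linarith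
  also have "\<dots> = Q * (1 + lam)\<^sup>2 / lam" using assms(8) by (simp add: field_simps power2_eq_square)
  finally show ?thesis .
qed

text \<open>The two steps increase \<open>s\<close> and then \<open>u\<close>. The hypotheses on
  \<open>2 * w * t\<close> and \<open>Q * t^2\<close> are what keeps both partial derivatives
  nonnegative.\<close>

lemma unbalanced_mono:
  fixes Q S s t u w :: real
  assumes "0 \<le> u" "u \<le> w" "0 \<le> s" "s \<le> t" "0 \<le> Q" "2 * w * t \<le> S" "Q * t\<^sup>2 \<le> 1"
  shows "(Q + u) * (1 + S * s - u * s\<^sup>2) \<le> (Q + w) * (1 + S * t - w * t\<^sup>2)"
proof -
  have "(Q + u) * (1 + S * s - u * s\<^sup>2) \<le> (Q + u) * (1 + S * t - u * t\<^sup>2)"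
  proof (rule mult_left_mono)
    have "u * (t + s) \<le> w * (2 * t)" using assms by (intro mult_mono) auto
    then have "0 \<le> (t - s) * (S - u * (t + s))" using assms by simp
    then show "1 + S * s - u * s\<^sup>2 \<le> 1 + S * t - u * t\<^sup>2" by (simp add: algebra_simps power2_eq_square)
  qed (use assms in simp)
  also have "\<dots> \<le> (Q + w) * (1 + S * t - w * t\<^sup>2)"
  proof -
    have "(u + w) * t \<le> 2 * w * t" using assms by (intro mult_right_mono) auto
    then have "(u + w) * t \<le> S" using assms by linarith
    then have "(u + w) * t * t \<le> S * t" using assms by (intro mult_right_mono) auto
    then have "0 \<le> (w - u) * (1 + S * t - t\<^sup>2 * Q - t\<^sup>2 * (u + w))"
      using assms by (intro mult_nonneg_nonneg) (auto simp: power2_eq_square mult_ac)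
    then show ?thesis by (simp add: algebra_simps)
  qed
  finally show ?thesis .
qed

text \<open>With \<open>u = a * b\<close> and \<open>s = 1 / a\<close>, the bounds
  \<open>f <= S - b\<close> and \<open>g <= Q * s\<close> give
  \<open>(Q + u) * (1 + S * s - u * s^2)\<close>. The worst case is \<open>a = T\<close> and
  \<open>a * b = w\<close>.\<close>

lemma product_bound_unbalanced:
  fixes f a g b Q S T w :: real
  assumes nn: "0 \<le> f" "0 \<le> g" "0 \<le> b" and "f + b \<le> S" "g * a \<le> Q" "0 < T" "T \<le> a" "a * b \<le> w"
    and Q: "0 \<le> Q" "Q \<le> T\<^sup>2" and w: "2 * w \<le> S * T"
  shows "(f + a) * (g + b) \<le> (Q + w) * (1 + S / T - w / T\<^sup>2)"
proof -
  define s t where "s = 1 / a" and "t = 1 / T"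
  have a: "0 < a" using assms by linarith
  have st: "0 < s" "0 < t" "s \<le> t" using assms a by (auto simp: s_def t_def frac_le)
  define u where "u = a * b"
  have u: "0 \<le> u" "u \<le> w" using assms a by (auto simp: u_def)
  have wt: "2 * w * t \<le> S" using w assms(6) by (simp add: t_def field_simps)
  have Qt: "Q * t\<^sup>2 \<le> 1" using Q assms(6) by (simp add: t_def power_divide)
  have b: "b = u * s" using a by (simp add: u_def s_def)
  have g: "g \<le> Q * s" using assms(5) a by (simp add: s_def field_simps)
  have as: "a * s = 1" using a by (simp add: s_def)
  have "(f + a) * (g + b) \<le> (S - b + a) * (Q * s + u * s)"
    using assms g a st u b by (intro mult_mono) auto
  also have "\<dots> = (Q + u) * (S * s - u * (s * s) + a * s)" unfolding b by (simp add: algebra_simps)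
  also have "\<dots> = (Q + u) * (1 + S * s - u * s\<^sup>2)" using as by (simp add: power2_eq_square)
  also have "\<dots> \<le> (Q + w) * (1 + S * t - w * t\<^sup>2)"
    using u st wt Qt Q by (intro unbalanced_mono) auto
  finally show ?thesis by (simp add: t_def power_divide)
qed


text \<open>Here \<open>l = k - 1\<close> and \<open>r = n - k - 1\<close>, so that \<open>S = (n - 1 choose (k - 1))\<close> and
  \<open>R = (n - 2 choose (k - 1))\<close>. A deletion counts as large when it has more than \<open>\<alpha> * R\<close> members.\<close>

locale hm_parameters =
  fixes l r :: nat and \<alpha> :: real and S R E Q h w lam :: real
  defines "S \<equiv> real (Suc (l + r) choose l)"
    and "R \<equiv> real (l + r choose l)"
    and "E \<equiv> real (r choose l)"
    and "Q \<equiv> R\<^sup>2 * (real l * (real r + 1) / (real r * (real r + 2)))"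
    and "h \<equiv> S - E + 1"
    and "lam \<equiv> (real l + 1) / real r"
    and "w \<equiv> (if r \<le> 2 * l + 1 then lam * Q else (real (Suc (l + r) choose (l - 1)))\<^sup>2)"
  assumes lr: "3 \<le> l" "l < r"
    and \<alpha>: "1 / 2 \<le> \<alpha>" "\<alpha> < 1"
    and excess: "E \<le> \<alpha> * (1 - \<alpha>) * (1 - l / r) * R"
    and small_threshold: "real (l + r - 2 choose (l - 1)) \<le> \<alpha> * R"
    and trivial_bound: "(S - (l + r - 1 choose l)) * S + Q \<le> h\<^sup>2"
    and balanced_bound: "r \<le> 2 * l + 1 \<Longrightarrow> Q * (1 + lam)\<^sup>2 / lam \<le> h\<^sup>2"
    and w_le: "2 * w \<le> S * (\<alpha> * R)"
    and Q_le: "Q \<le> (\<alpha> * R)\<^sup>2"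
    and unbalanced_bound: "(Q + w) * (1 + S / (\<alpha> * R) - w / (\<alpha> * R)\<^sup>2) \<le> h\<^sup>2"
begin

lemma R_pos: "0 < R"
  by (simp add: R_def)

lemma Q_pos: "0 < Q"
  using lr R_pos by (simp add: Q_def)

lemma choose_l_minus_1: "real (l + r choose (l - 1)) = S - R" "S - R = R * l / (real r + 1)"
proof -
  obtain l' where l': "l = Suc l'" using lr by (cases l) auto
  show eq: "real (l + r choose (l - 1)) = S - R" by (simp add: S_def R_def l')
  have "real (l + r - l') = real r + 1" using l' by simp
  then have "real l * R = (real r + 1) * real (l + r choose (l - 1))"
    using choose_Suc_ratio_real[of l' "l + r"] l' unfolding R_def
    by (simp add: add.commute del: binomial_Suc_Suc)
  then have "real l * R = (real r + 1) * (S - R)" unfolding eq .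
  then show "S - R = R * l / (real r + 1)" by (simp add: field_simps)
qed

lemma excess_bound:
  assumes "A \<subseteq> uniform X l" "B \<subseteq> uniform X k" "finite X" "cross_intersecting A B"
    and "r = card X - k" "B \<noteq> {}" "card B \<le> \<alpha> * R"
  shows "real (card A) + real (card B) \<le> real (card X choose l) - E + 1"
  using cross_excess_bound[OF assms(1-6), of \<alpha>] assms(7) lr \<alpha> excess unfolding E_def R_def by simp

lemma product_bound:
  assumes "A \<subseteq> uniform X l" "B \<subseteq> uniform X (Suc l)" "finite X" "cross_intersecting A B"
    and "card X = Suc (l + r)"
  shows "real (card A) * real (card B) \<le> Q"
  using cross_product_bound[OF assms] lr unfolding Q_def R_def by simp

lemma compressed_bound:
  assumes F: "F \<subseteq> uniform X (Suc l)" and G: "G \<subseteq> uniform X (Suc l)" and X: "finite X" "i \<in> X"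
    and cX: "card X = Suc (Suc (l + r))" and c: "cross_intersecting F G"
    and shF: "\<And>j. j \<in> X \<Longrightarrow> shift i j F = F" and shG: "\<And>j. j \<in> X \<Longrightarrow> shift i j G = G"
    and le: "card (deletion G i) \<le> card (deletion F i)" and big: "\<alpha> * R < card (deletion F i)"
    and walk: "2 * l + 1 < r \<Longrightarrow>
      card (deletion F i) * card (deletion G i) \<le> (Suc (l + r) choose (l - 1))\<^sup>2"
  shows "real (card F) * real (card G) \<le> h\<^sup>2"
proof -
  let ?X = "X - {i}"
  have X': "finite ?X" "card ?X = Suc (l + r)" using X cX by auto
  define f a g b where "f = real (card (link F i))" and "a = real (card (deletion F i))"
    and "g = real (card (link G i))" and "b = real (card (deletion G i))"
  note fams = link_uniform[OF F, of i] link_uniform[OF G, of i]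
    deletion_uniform[OF F, of i] deletion_uniform[OF G, of i]
  have c1: "cross_intersecting (link F i) (deletion G i)" by (rule cross_link_deletion[OF c])
  have c2: "cross_intersecting (link G i) (deletion F i)"
    by (rule cross_link_deletion[OF cross_intersecting_sym[OF c]])
  have rX: "r = card ?X - Suc l" using X'(2) by simp
  have Rr: "l + r choose r = l + r choose l"
    by (metis add.commute binomial_symmetric le_add1 add_diff_cancel_left')
  have prods: "f * b \<le> Q" "g * a \<le> Q"
    using product_bound[OF fams(1,4) X'(1) c1 X'(2)] product_bound[OF fams(2,3) X'(1) c2 X'(2)]
    by (auto simp: f_def b_def g_def a_def)
  have sizes: "real (card F) = f + a" "real (card G) = g + b"
    using card_link_deletion[OF finite_uniform[OF X(1) F], of i]
      card_link_deletion[OF finite_uniform[OF X(1) G], of i]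
    by (auto simp: f_def a_def g_def b_def)
  have shadow_b: "real (card (shadow l (deletion G i))) \<le> g"
    unfolding g_def using shadow_deletion_subset_link[OF G X(1) shG]
    by (intro of_nat_mono card_mono finite_uniform[OF X'(1) fams(2)])
  have r0: "0 < real r" using lr by simp
  \<comment> \<open>If both deletions exceeded \<open>R\<close>, that of \<open>F\<close> would
    force \<open>g <= R * l / (r + 1)\<close>, while compression and the normalised shadow on all
    \<open>n - 1\<close> remaining elements give \<open>g >= b * (l + 1) / (r + 1)\<close>.\<close>
  have bR: "b \<le> R"
  proof (rule ccontr)
    assume "\<not> b \<le> R"
    then have "R < b" "R < a" using le by (auto simp: a_def b_def)
    then have "l + r choose r \<le> card (deletion F i)"
      unfolding Rr by (simp add: R_def a_def)
    then have "card (link G i) + (l + r choose l) \<le> card ?X choose l"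
      using cross_large_bound[OF fams(2,3) X'(1) c2 rX, of "l + r"] lr by simp
    then have g: "g \<le> R * l / (real r + 1)"
      unfolding choose_l_minus_1(2)[symmetric] by (simp add: g_def S_def R_def X'(2) del: binomial_Suc_Suc)
    have CC: "(real l + 1) * real (Suc (l + r) choose Suc l) = (real r + 1) * S"
      using choose_Suc_ratio_real[of l "Suc (l + r)"] unfolding S_def
      by (simp add: Suc_diff_le add_ac del: binomial_Suc_Suc)
    have "card (deletion G i) \<le> Suc (l + r) choose Suc l"
      using card_mono[OF _ fams(4)] card_uniform[OF X'(1)] X' by simp
    then have "real (Suc (l + r) choose l) * (b / (Suc (l + r) choose Suc l)) \<le> g"
      using shadow_normalized[OF fams(4) X'(1), of "Suc (l + r)" l] shadow_b lr unfolding b_def by simp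
    moreover have "real (Suc (l + r) choose Suc l) = (real r + 1) * S / (real l + 1)"
      using CC by (simp add: field_simps)
    ultimately have "S * (b / ((real r + 1) * S / (real l + 1))) \<le> g" unfolding S_def by (simp only:)
    moreover have "0 < S" by (simp add: S_def)
    then have "S * (b / ((real r + 1) * S / (real l + 1))) = b * (real l + 1) / (real r + 1)" by simp
    ultimately have "b * (real l + 1) / (real r + 1) \<le> g" by simp
    then have "b * (real l + 1) / (real r + 1) \<le> R * l / (real r + 1)" using g by linarith
    then have "b * (real l + 1) \<le> R * l" by (simp add: divide_le_cancel)
    moreover have "R * (real l + 1) < b * (real l + 1)" using \<open>R < b\<close> by simp
    ultimately show False using R_pos by (simp add: algebra_simps)
  qed
  have fb: "f + b \<le> S"
    using cross_small_bound[OF fams(1,4) X'(1) c1 rX] lr bR X'(2)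
    unfolding S_def f_def b_def R_def by (simp del: binomial_Suc_Suc)
  \<comment> \<open>The shadow argument is repeated with the smaller reference size
    \<open>l + r\<close>, admissible because \<open>b <= R\<close>. It gives
    \<open>g >= lam * b\<close>, the origin of \<open>lam\<close>.\<close>
  have "lam * (a * b) \<le> Q"
  proof -
    have CC: "(real l + 1) * real (l + r choose Suc l) = r * R"
      using choose_Suc_ratio_real[of l "l + r"] unfolding R_def by simp
    have "(real l + 1) * R \<le> r * R" using lr R_pos by (intro mult_right_mono) auto
    then have "R \<le> real (l + r choose Suc l)"
      unfolding CC[symmetric] by (rule mult_left_le_imp_le) simp
    then have "card (deletion G i) \<le> l + r choose Suc l" using bR by (simp add: b_def)
    then have "R * (b / (l + r choose Suc l)) \<le> g"
      using shadow_normalized[OF fams(4) X'(1), of "l + r" l] shadow_b lr unfolding b_def R_def by simp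
    moreover have "real (l + r choose Suc l) = r * R / (real l + 1)" using CC by (simp add: field_simps)
    moreover have "R * (b / (r * R / (real l + 1))) = lam * b" using R_pos by (simp add: lam_def)
    ultimately have "lam * b \<le> g" by (simp only:)
    then have "lam * b * a \<le> g * a" by (rule mult_right_mono) (simp add: a_def)
    then show ?thesis using prods(2) by (simp add: mult_ac)
  qed
  show ?thesis
  \<comment> \<open>The balanced range for \<open>a * b\<close> is from \<open>lam * Q\<close> to
    \<open>Q / lam\<close>. Outside it \<open>a * b <= w\<close>, by the failed lower bound when
    \<open>n <= 3 k\<close> and by the walk bound when \<open>n > 3 k\<close>.\<close>
  proof (cases "r \<le> 2 * l + 1 \<and> lam * Q \<le> a * b")
    case True
    then have "(f + a) * (g + b) \<le> Q * (1 + lam)\<^sup>2 / lam"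
      using product_bound_balanced[of f a g b Q lam] prods Q_pos r0 \<open>lam * (a * b) \<le> Q\<close>
      by (auto simp: f_def a_def g_def b_def lam_def)
    then show ?thesis using balanced_bound True by (simp add: sizes)
  next
    case False
    have "a * b \<le> w"
    proof (cases "r \<le> 2 * l + 1")
      case True then show ?thesis using False by (simp add: w_def)
    next
      case r: False
      then have "real (card (deletion F i) * card (deletion G i)) \<le> real ((Suc (l + r) choose (l - 1))\<^sup>2)"
        using walk by (intro of_nat_mono) simp
      then show ?thesis using r by (simp add: w_def a_def b_def del: binomial_Suc_Suc)
    qed
    then have "(f + a) * (g + b) \<le> (Q + w) * (1 + S / (\<alpha> * R) - w / (\<alpha> * R)\<^sup>2)"
      using product_bound_unbalanced[of f g b S a Q "\<alpha> * R" w] fb prods big Q_pos Q_le w_le R_pos \<alpha>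
      by (auto simp: f_def a_def g_def b_def)
    then show ?thesis using unbalanced_bound by (simp add: sizes)
  qed
qed

end

section \<open>Lattice walks of shifted families\<close>

definition shifted :: "nat \<Rightarrow> nat set set \<Rightarrow> bool" where
  "shifted n F \<longleftrightarrow> (\<forall>i j. 1 \<le> i \<and> i < j \<and> j \<le> n \<longrightarrow> shift i j F = F)"

lemma shifted_replace:
  assumes "shifted n F" "A \<in> F" "1 \<le> y" "y < x" "x \<le> n" "x \<in> A" "y \<notin> A"
  shows "insert y (A - {x}) \<in> F"
proof -
  have "shift_set y x A \<in> shift y x F" by (rule shift_set_in_shift[OF assms(2)])
  then show ?thesis using assms by (simp add: shifted_def shift_set_def)
qed

text \<open>Suppose no prefix is overfull. Then the least common element \<open>x\<close> has a free
  place \<open>y < x\<close>, and moving \<open>x\<close> to \<open>y\<close> in \<open>A\<close>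
  stays in \<open>F\<close> and removes a common element. Prefixes ending at or after
  \<open>x\<close> keep their counts; shorter ones contain no common element and so cannot be
  overfull. Repetition ends with a disjoint pair.\<close>

lemma shifted_cross_prefix:
  assumes F: "shifted n F" "F \<subseteq> uniform {1..n} k" and G: "G \<subseteq> uniform {1..n} k"
    and c: "cross_intersecting F G" and A: "A \<in> F" and B: "B \<in> G"
  shows "\<exists>j\<le>n. j < card (A \<inter> {1..j}) + card (B \<inter> {1..j})"
proof -
  have sum: "card (A \<inter> {1..j}) + card (B \<inter> {1..j})
      = card ((A \<union> B) \<inter> {1..j}) + card (A \<inter> B \<inter> {1..j})" for A B :: "nat set" and j
    using card_Un_Int[of "A \<inter> {1..j}" "B \<inter> {1..j}"] by (simp add: Int_Un_distrib2 Int_ac)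
  have "\<not> (\<forall>j\<le>n. card (A \<inter> {1..j}) + card (B \<inter> {1..j}) \<le> j)" if "A \<in> F" for A
    using that
  proof (induction "card (A \<inter> B)" arbitrary: A)
    case 0
    have "B \<subseteq> {1..n}" using B G by auto
    then have "finite (A \<inter> B)" using finite_subset by auto
    then have "A \<inter> B = {}" using 0 by simp
    then show ?case using c 0 B unfolding cross_intersecting_def by blast
  next
    case (Suc m)
    have AB: "A \<inter> B \<subseteq> {1..n}" using B G by auto
    then have fin: "finite (A \<inter> B)" by (rule finite_subset) simp
    have ne: "A \<inter> B \<noteq> {}" using Suc.hyps(2) by auto
    define x where "x = Min (A \<inter> B)"
    have x: "x \<in> A" "x \<in> B" "1 \<le> x" "x \<le> n" using Min_in[OF fin ne] AB by (auto simp: x_def)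
    have xmin: "x \<le> z" if "z \<in> A" "z \<in> B" for z using that fin by (simp add: x_def)
    show ?case
    proof
      assume H: "\<forall>j\<le>n. card (A \<inter> {1..j}) + card (B \<inter> {1..j}) \<le> j"
      have "x \<in> A \<inter> B \<inter> {1..x}" using x by simp
      then have "0 < card (A \<inter> B \<inter> {1..x})" by (metis card_gt_0_iff empty_iff finite_Int finite_atLeastAtMost)
      then have "card ((A \<union> B) \<inter> {1..x}) < x" using H x(4) sum[of A x B] by fastforce
      then have "(A \<union> B) \<inter> {1..x} \<noteq> {1..x}" by (metis card_atLeastAtMost diff_Suc_1 less_irrefl)
      then obtain y where "y \<in> {1..x}" "y \<notin> A \<union> B" by blast
      then have y: "y \<notin> A" "y \<notin> B" "1 \<le> y" "y \<le> x" by auto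
      have yx: "y < x" using y x by (metis le_neq_implies_less)
      define A' where "A' = insert y (A - {x})"
      have A': "A' \<in> F" unfolding A'_def by (rule shifted_replace[OF F(1) Suc.prems]) (use x y yx in auto)
      have "A' \<inter> B = A \<inter> B - {x}" using y by (auto simp: A'_def)
      then have "m = card (A' \<inter> B)" using Suc.hyps(2) x fin by (simp add: card_Diff_singleton)
      moreover have "card (A' \<inter> {1..j}) + card (B \<inter> {1..j}) \<le> j" if j: "j \<le> n" for j
      proof (cases "x \<le> j")
        case True
        have "A' \<inter> {1..j} = insert y ((A \<inter> {1..j}) - {x})" using y yx True by (auto simp: A'_def)
        then have "card (A' \<inter> {1..j}) = card (A \<inter> {1..j})"
          using card_shift_set[of "A \<inter> {1..j}" y x] x y True by (simp add: shift_set_def)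
        then show ?thesis using H j by simp
      next
        case False
        then have "A' \<inter> B \<inter> {1..j} = {}" using xmin \<open>A' \<inter> B = A \<inter> B - {x}\<close> by force
        moreover have "card ((A' \<union> B) \<inter> {1..j}) \<le> card {1..j}" by (intro card_mono) auto
        ultimately show ?thesis using sum[of A' j B] by simp
      qed
      ultimately show False using Suc.hyps(1)[of A'] A' by blast
    qed
  qed
  from this[OF A] show ?thesis by (meson not_le)
qed

text \<open>The sets are read as lattice walks, an element of \<open>A\<close> being an up-step; the count is the
  reflection principle.\<close>

definition reaching :: "nat \<Rightarrow> nat \<Rightarrow> nat \<Rightarrow> nat \<Rightarrow> nat set set" where
  "reaching m N k t = {A \<in> uniform {Suc m..m + N} k. \<exists>j\<le>N. j + t \<le> 2 * card (A \<inter> {Suc m..m + j})}"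

text \<open>An induction on the first step replaces the reflection: an up-step leaves height
  \<open>t - 1\<close> to climb with \<open>k - 1\<close> up-steps, a down-step leaves
  \<open>t + 1\<close> with \<open>k\<close>. The two bounds have lower indices \<open>k - t\<close>
  and \<open>k - t - 1\<close> and add up by Pascal's rule. The offset \<open>m\<close> allows the
  rest of a walk to start one place later.\<close>

lemma card_reaching: "card (reaching m N k t) \<le> (if t \<le> k then N choose (k - t) else 0)"
proof (induction N arbitrary: m k t)
  case 0
  have "reaching m 0 k t \<subseteq> (if t \<le> k \<and> k = t then {{}} else {})"
    by (auto simp: reaching_def)
  then have "card (reaching m 0 k t) \<le> card (if t \<le> k \<and> k = t then {{}} else {} :: nat set set)"
    by (intro card_mono) auto
  then show ?case by (auto split: if_splits)
next
  case (Suc N)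
  have fin: "finite (reaching m N k t)" for m N k t
    by (rule finite_subset[of _ "Pow {Suc m..m + N}"]) (auto simp: reaching_def)
  show ?case
  proof (cases t)
    case 0
    have "card (reaching m (Suc N) k t) \<le> card (uniform {Suc m..m + Suc N} k)"
      by (intro card_mono) (auto simp: reaching_def intro: finite_subset[of _ "Pow {Suc m..m + Suc N}"])
    then show ?thesis using 0 by (simp add: card_uniform)
  next
    case t: (Suc t')
    let ?U = "{A \<in> reaching m (Suc N) k t. Suc m \<in> A}"
    let ?D = "{A \<in> reaching m (Suc N) k t. Suc m \<notin> A}"
    have prefix: "{Suc m..m + Suc j} = insert (Suc m) {Suc (Suc m)..Suc m + j}" for j by auto
    have D: "?D \<subseteq> reaching (Suc m) N k (Suc t)"
    proof
      fix A assume "A \<in> ?D"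
      then obtain j where A: "A \<subseteq> {Suc m..m + Suc N}" "card A = k" "Suc m \<notin> A"
        and j: "j \<le> Suc N" "j + t \<le> 2 * card (A \<inter> {Suc m..m + j})" by (auto simp: reaching_def)
      obtain j' where j': "j = Suc j'" using j t by (cases j) auto
      have "A \<subseteq> {Suc (Suc m)..Suc m + N}" using A prefix[of N] by auto
      moreover have "j' + Suc t \<le> 2 * card (A \<inter> {Suc (Suc m)..Suc m + j'})"
        using j(2) A(3) unfolding j' prefix by simp
      ultimately show "A \<in> reaching (Suc m) N k (Suc t)"
        using A(2) j(1) j' unfolding reaching_def by auto
    qed
    have U: "card ?U \<le> (if t \<le> k then N choose (k - t) else 0)"
    proof (cases k)
      case 0
      then have "?U = {}" by (auto simp: reaching_def dest!: finite_subset[OF _ finite_atLeastAtMost])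
      then show ?thesis by (simp only: card.empty)
    next
      case k: (Suc k')
      have "(\<lambda>A. A - {Suc m}) ` ?U \<subseteq> reaching (Suc m) N k' t'"
      proof
        fix A' assume "A' \<in> (\<lambda>A. A - {Suc m}) ` ?U"
        then obtain A j where A: "A' = A - {Suc m}" "A \<subseteq> {Suc m..m + Suc N}" "card A = k" "Suc m \<in> A"
          and j: "j \<le> Suc N" "j + t \<le> 2 * card (A \<inter> {Suc m..m + j})" by (auto simp: reaching_def)
        obtain j' where j': "j = Suc j'" using j t by (cases j) auto
        have "A' \<subseteq> {Suc (Suc m)..Suc m + N}" using A prefix[of N] by auto
        moreover have "card A' = k'" using A k by (simp add: card_Diff_singleton)
        moreover have "A \<inter> {Suc m..m + j} = insert (Suc m) (A' \<inter> {Suc (Suc m)..Suc m + j'})"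
          using A unfolding j' prefix by auto
        then have "card (A \<inter> {Suc m..m + j}) = Suc (card (A' \<inter> {Suc (Suc m)..Suc m + j'}))" by simp
        then have "j' + t' \<le> 2 * card (A' \<inter> {Suc (Suc m)..Suc m + j'})" using j(2) j' t by simp
        ultimately show "A' \<in> reaching (Suc m) N k' t'" using j(1) j' unfolding reaching_def by auto
      qed
      then have "card ((\<lambda>A. A - {Suc m}) ` ?U) \<le> card (reaching (Suc m) N k' t')"
        by (rule card_mono[OF fin])
      moreover have "card ((\<lambda>A. A - {Suc m}) ` ?U) = card ?U"
        by (rule card_image) (auto simp: inj_on_def)
      ultimately have "card ?U \<le> card (reaching (Suc m) N k' t')" by (simp only:)
      also have "\<dots> \<le> (if t' \<le> k' then N choose (k' - t') else 0)" by (rule Suc.IH)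
      finally show ?thesis unfolding k t by (simp only: Suc_le_mono diff_Suc_Suc)
    qed
    have "reaching m (Suc N) k t = ?U \<union> ?D" by auto
    then have "card (reaching m (Suc N) k t) \<le> card ?U + card ?D" by (metis card_Un_le)
    also have "card ?D \<le> (if Suc t \<le> k then N choose (k - Suc t) else 0)"
      using card_mono[OF fin D] Suc.IH[of "Suc m" k "Suc t"] by linarith
    also have "card ?U + (if Suc t \<le> k then N choose (k - Suc t) else 0)
        \<le> (if t \<le> k then Suc N choose (k - t) else 0)"
    proof (cases "t < k")
      case True
      then obtain p where "k - t = Suc p" by (metis Suc_diff_Suc)
      moreover have "k - Suc t = p" using \<open>k - t = Suc p\<close> by simp
      ultimately show ?thesis using U True by simp
    next
      case False
      then show ?thesis using U by (cases "t = k") auto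
    qed
    finally show ?thesis by simp
  qed
qed

lemma choose_log_concave: "(N choose j) * (N choose (j + 2)) \<le> (N choose (j + 1))\<^sup>2"
proof (cases "j + 2 \<le> N")
  case False
  then have "N choose (j + 2) = 0" by (intro binomial_eq_0) simp
  then show ?thesis by (simp only: mult_0_right le0)
next
  case True
  define c0 c1 c2 where "c0 = real (N choose j)" and "c1 = real (N choose (j + 1))"
    and "c2 = real (N choose (j + 2))"
  have 1: "(real j + 1) * c1 = (real N - j) * c0"
    using choose_Suc_ratio_real[of j N] True by (simp add: c0_def c1_def of_nat_diff)
  have 2: "(real j + 2) * c2 = (real N - j - 1) * c1"
    using choose_Suc_ratio_real[of "Suc j" N] True by (simp add: c1_def c2_def of_nat_diff add_ac)
  have c: "0 \<le> c0" "0 \<le> c1" "0 \<le> c2" by (auto simp: c0_def c1_def c2_def)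
  have N: "0 < real N - j" using True by simp
  have "(real N - j) * (real j + 2) * (c0 * c2) = ((real N - j) * c0) * ((real j + 2) * c2)" by simp
  also have "\<dots> = ((real j + 1) * (real N - j - 1)) * c1\<^sup>2"
    unfolding 1[symmetric] 2 by (simp add: power2_eq_square)
  also have "\<dots> \<le> ((real N - j) * (real j + 2)) * c1\<^sup>2"
    using True by (intro mult_right_mono) (auto simp: algebra_simps)
  finally have "c0 * c2 \<le> c1\<^sup>2" using N by simp
  then have "real ((N choose j) * (N choose (j + 2))) \<le> real ((N choose (j + 1))\<^sup>2)"
    by (simp add: c0_def c1_def c2_def)
  then show ?thesis by (simp only: of_nat_le_iff)
qed

lemma choose_log_concave2: "(N choose j) * (N choose (j + 4)) \<le> (N choose (j + 2))\<^sup>2"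
proof (cases "j + 2 \<le> N")
  case False
  then have "N choose (j + 4) = 0" by (intro binomial_eq_0) simp
  then show ?thesis by (simp only: mult_0_right le0)
next
  case True
  define c where "c i = N choose (j + i)" for i
  have lc: "c i * c (i + 2) \<le> (c (i + 1))\<^sup>2" for i
    using choose_log_concave[of N "j + i"] by (simp add: c_def add_ac)
  have pos: "0 < (c 2)\<^sup>2" using True by (simp add: c_def)
  have "(c 0 * c 4) * (c 2)\<^sup>2 = (c 0 * c 2) * (c 2 * c 4)" by (simp add: power2_eq_square)
  also have "\<dots> \<le> (c 1)\<^sup>2 * (c 3)\<^sup>2" using lc[of 0] lc[of 2] by (intro mult_mono) (simp_all add: numeral_eq_Suc)
  also have "\<dots> = (c 1 * c 3)\<^sup>2" by (simp add: power_mult_distrib)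
  also have "\<dots> \<le> ((c 2)\<^sup>2)\<^sup>2" using lc[of 1] by (intro power_mono) (simp_all add: numeral_eq_Suc)
  also have "\<dots> = (c 2)\<^sup>2 * (c 2)\<^sup>2" by (rule power2_eq_square)
  finally have "c 0 * c 4 \<le> (c 2)\<^sup>2" by (rule mult_right_le_imp_le[OF _ pos])
  then show ?thesis by (simp add: c_def)
qed

text \<open>For every pair some prefix has walk heights adding up to at least 4. Hence both families
  always reach height 2, or one fails height 2 and the other always reaches 3, or one fails height 1
  and the other always reaches 4. The lower indices \<open>k - t\<close> of the two counts add up to
  \<open>2 * k - 4\<close> each time, and log-concavity makes the equal split the largest.\<close>

lemma shifted_deletion_product:
  assumes n: "0 < n" and k: "4 \<le> k"
    and F: "shifted n F" "F \<subseteq> uniform {1..n} k" and G: "G \<subseteq> uniform {1..n} k"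
    and c: "cross_intersecting F G"
  shows "card (deletion F 1) * card (deletion G 1) \<le> (n - 1 choose (k - 2))\<^sup>2"
proof -
  define N where "N = n - 1"
  have nN: "n = Suc N" using n by (simp add: N_def)
  define p where "p A j = card (A \<inter> {Suc 1..1 + j})" for A :: "nat set" and j
  have range: "{1..n} - {1} = {Suc 1..1 + N}" using nN by auto
  have dF: "deletion F 1 \<subseteq> uniform {Suc 1..1 + N} k" and dG: "deletion G 1 \<subseteq> uniform {Suc 1..1 + N} k"
    using deletion_uniform[OF F(2), of 1] deletion_uniform[OF G, of 1] unfolding range .
  \<comment> \<open>Neither set contains 1, so dropping the first position shortens the prefix by
    one and keeps the counts; the strict inequality then yields \<open>j + 2\<close>.\<close>
  have key: "\<exists>j\<le>N. j + 2 \<le> p A j + p B j" if "A \<in> deletion F 1" "B \<in> deletion G 1" for A B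
  proof -
    have AB: "A \<in> F" "B \<in> G" "1 \<notin> A" "1 \<notin> B" using that by (auto simp: deletion_def)
    obtain j where j: "j \<le> n" "j < card (A \<inter> {1..j}) + card (B \<inter> {1..j})"
      using shifted_cross_prefix[OF F G c AB(1,2)] by blast
    obtain j' where j': "j = Suc j'" using j by (cases j) auto
    have "S \<inter> {1..j} = S \<inter> {Suc 1..1 + j'}" if "1 \<notin> S" for S :: "nat set"
    proof -
      have "{1..j} = insert 1 {Suc 1..1 + j'}" using j' by auto
      then show ?thesis using that by simp
    qed
    then have "j < p A j' + p B j'" using j(2) AB by (simp add: p_def)
    then show ?thesis using j(1) j' nN by (intro exI[of _ j']) auto
  qed
  have bound: "card D \<le> N choose (k - t)"
    if "D \<subseteq> uniform {Suc 1..1 + N} k" "\<And>A. A \<in> D \<Longrightarrow> \<exists>j\<le>N. j + t \<le> 2 * p A j" "t \<le> k" for D t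
  proof -
    have "D \<subseteq> reaching 1 N k t" using that(1,2) by (auto simp: reaching_def p_def)
    moreover have "finite (reaching 1 N k t)"
      by (rule finite_subset[of _ "Pow {Suc 1..1 + N}"]) (auto simp: reaching_def)
    ultimately have "card D \<le> card (reaching 1 N k t)" by (rule card_mono[rotated])
    then show ?thesis using card_reaching[of 1 N k t] that(3) by simp
  qed
  have main: "card D1 * card D2 \<le> (N choose (k - 2))\<^sup>2"
    if D: "D1 \<subseteq> uniform {Suc 1..1 + N} k" "D2 \<subseteq> uniform {Suc 1..1 + N} k"
      and key: "\<And>A B. A \<in> D1 \<Longrightarrow> B \<in> D2 \<Longrightarrow> \<exists>j\<le>N. j + 2 \<le> p A j + p B j"
      and A: "A \<in> D1" "\<not> (\<exists>j\<le>N. j + 2 \<le> 2 * p A j)" for D1 D2 A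
  proof (cases "\<forall>A'\<in>D1. \<exists>j\<le>N. j + 1 \<le> 2 * p A' j")
    case True
    have "\<exists>j\<le>N. j + 3 \<le> 2 * p B j" if B: "B \<in> D2" for B
    proof -
      obtain j where j: "j \<le> N" "j + 2 \<le> p A j + p B j" using key[OF A(1) B] by blast
      moreover have "\<not> j + 2 \<le> 2 * p A j" using A(2) j(1) by blast
      ultimately show ?thesis by (intro exI[of _ j]) auto
    qed
    then have "card D2 \<le> N choose (k - 3)" using bound[OF D(2)] k by auto
    moreover have "card D1 \<le> N choose (k - 1)" using bound[OF D(1), of 1] True k by auto
    ultimately have "card D1 * card D2 \<le> (N choose (k - 1)) * (N choose (k - 3))" by (intro mult_mono) auto
    moreover have "k - 3 + 2 = k - 1" "k - 3 + 1 = k - 2" using k by auto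
    ultimately show ?thesis using choose_log_concave[of N "k - 3"] by (metis mult.commute order_trans)
  next
    case False
    then obtain A' where A'0: "A' \<in> D1" "\<not> (\<exists>j\<le>N. j + 1 \<le> 2 * p A' j)" by blast
    have A': "2 * p A' j \<le> j" if "j \<le> N" for j
    proof -
      have "\<not> j + 1 \<le> 2 * p A' j" using A'0(2) that by blast
      then show ?thesis by linarith
    qed
    have "\<exists>j\<le>N. j + 4 \<le> 2 * p B j" if B: "B \<in> D2" for B
    proof -
      obtain j where "j \<le> N" "j + 2 \<le> p A' j + p B j" using key[OF A'0(1) B] by blast
      then show ?thesis using A'[of j] by (intro exI[of _ j]) auto
    qed
    then have "card D2 \<le> N choose (k - 4)" using bound[OF D(2)] k by auto
    moreover have "card D1 \<le> N choose k"
      using card_mono[OF _ D(1)] card_uniform[of "{Suc 1..1 + N}" k] by (simp add: finite_uniform[of "{Suc 1..1 + N}"])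
    ultimately have "card D1 * card D2 \<le> (N choose k) * (N choose (k - 4))" by (intro mult_mono) auto
    moreover have "k - 4 + 4 = k" "k - 4 + 2 = k - 2" using k by auto
    ultimately show ?thesis using choose_log_concave2[of N "k - 4"] by (metis mult.commute order_trans)
  qed
  consider (1) A where "A \<in> deletion F 1" "\<not> (\<exists>j\<le>N. j + 2 \<le> 2 * p A j)"
    | (2) B where "B \<in> deletion G 1" "\<not> (\<exists>j\<le>N. j + 2 \<le> 2 * p B j)"
    | (3) "\<And>A. A \<in> deletion F 1 \<Longrightarrow> \<exists>j\<le>N. j + 2 \<le> 2 * p A j"
      "\<And>B. B \<in> deletion G 1 \<Longrightarrow> \<exists>j\<le>N. j + 2 \<le> 2 * p B j"
    by blast
  then show ?thesis
  proof cases
    case 1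
    then show ?thesis using main[OF dF dG key] by (simp add: N_def)
  next
    case 2
    have "\<exists>j\<le>N. j + 2 \<le> p B j + p A j" if "B \<in> deletion G 1" "A \<in> deletion F 1" for A B
      using key[OF that(2,1)] by (simp add: add.commute)
    then show ?thesis using main[OF dG dF _ 2] by (simp add: N_def mult.commute)
  next
    case 3
    then have "card (deletion F 1) \<le> N choose (k - 2)" "card (deletion G 1) \<le> N choose (k - 2)"
      using bound[OF dF, of 2] bound[OF dG, of 2] k by auto
    then show ?thesis unfolding power2_eq_square N_def by (intro mult_mono) auto
  qed
qed

section \<open>Non-trivial families\<close>

text \<open>A shift adds no element other than \<open>i\<close>. So when it makes a non-trivial
  family trivial, \<open>i\<close> is the only possible common element.\<close>

lemma shift_common_element:
  assumes "\<And>A. A \<in> shift i j F \<Longrightarrow> x \<in> A" and "x \<noteq> i" and "A \<in> F"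
  shows "x \<in> A"
  using assms(1)[OF shift_set_in_shift[OF assms(3)]] assms(2)
  by (auto simp: shift_set_def split: if_splits)

text \<open>A potential for the shifting process: a shift to a smaller element that changes the
  family lowers it strictly.\<close>

definition weight :: "nat set set \<Rightarrow> nat" where
  "weight F = (\<Sum>A\<in>F. \<Sum>A)"

lemma weight_shift:
  assumes F: "finite F" "\<And>A. A \<in> F \<Longrightarrow> finite A" and ij: "i < j"
  shows "weight (shift i j F) \<le> weight F"
    and "shift i j F \<noteq> F \<Longrightarrow> weight (shift i j F) < weight F"
proof -
  let ?f = "\<lambda>A. if shift_set i j A \<in> F then A else shift_set i j A"
  have w: "weight (shift i j F) = (\<Sum>A\<in>F. \<Sum>(?f A))"
    unfolding weight_def by (rule sum.reindex_bij_betw[OF bij_betw_shift, symmetric])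
  have lt: "\<Sum>(shift_set i j A) < \<Sum>A" if A: "A \<in> F" and ne: "shift_set i j A \<noteq> A" for A
  proof -
    have s: "j \<in> A" "i \<notin> A" "shift_set i j A = insert i (A - {j})"
      using ne by (auto simp: shift_set_def split: if_splits)
    have "\<Sum>(shift_set i j A) = i + \<Sum>(A - {j})" using s F(2)[OF A] by simp
    also have "\<dots> < j + \<Sum>(A - {j})" using ij by simp
    also have "\<dots> = \<Sum>A" using s(1) F(2)[OF A] by (simp add: sum.remove)
    finally show ?thesis .
  qed
  have le: "\<Sum>(?f A) \<le> \<Sum>A" if "A \<in> F" for A
    using lt[OF that] by (cases "shift_set i j A = A") auto
  show "weight (shift i j F) \<le> weight F" unfolding w unfolding weight_def by (rule sum_mono[OF le])
  assume ne: "shift i j F \<noteq> F"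
  have "\<exists>A\<in>F. ?f A \<noteq> A"
  proof (rule ccontr)
    assume "\<not> ?thesis"
    then have "?f ` F = F" by (auto simp: image_iff)
    then show False using ne bij_betw_imp_surj_on[OF bij_betw_shift, of i j F] by simp
  qed
  then obtain A where A: "A \<in> F" "?f A \<noteq> A" by blast
  then have "\<Sum>(?f A) < \<Sum>A" using lt[OF A(1)] by (auto split: if_splits)
  then show "weight (shift i j F) < weight F"
    unfolding w unfolding weight_def using A(1) by (intro sum_strict_mono_ex1 F(1) ballI le) blast+
qed

lemma non_trivial_iff: "non_trivial F \<longleftrightarrow> (\<forall>x. \<exists>A\<in>F. x \<notin> A)"
  unfolding non_trivial_def by auto

lemma mult_le_square_of_sum:
  fixes f g h :: real
  assumes "0 \<le> f" "0 \<le> g" "f + g \<le> 2 * h"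
  shows "f * g \<le> h\<^sup>2"
proof -
  have "4 * (f * g) \<le> (f + g)\<^sup>2" using sum_squares_bound[of f g] by (simp add: power2_eq_square algebra_simps)
  also have "\<dots> \<le> (2 * h)\<^sup>2" using assms by (intro power_mono) auto
  finally show ?thesis by (simp add: power_mult_distrib)
qed

context hm_parameters
begin

text \<open>Every member of \<open>F\<close> meets the pair of \<open>i\<close> and
  \<open>j\<close>. Indices record this trace: 12 for both, 1 for \<open>i\<close> only, 2 for
  \<open>j\<close> only, 0 for neither. In the main case \<open>F12\<close> with \<open>G0\<close>
  gives \<open>S - R\<close>, as does \<open>G12\<close> alone, and \<open>F1\<close> with
  \<open>G2\<close> and \<open>F2\<close> with \<open>G1\<close> give \<open>R - E + 1\<close> each;
  the total is \<open>2 * h\<close>.\<close>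

lemma trivial_shift_bound:
  assumes F: "F \<subseteq> uniform X (Suc l)" and G: "G \<subseteq> uniform X (Suc l)"
    and X: "finite X" "card X = Suc (Suc (l + r))" and ij: "i \<in> X" "j \<in> X" "i \<noteq> j"
    and c: "cross_intersecting F G" and nF: "non_trivial F" and nG: "non_trivial G"
    and trivial: "\<And>A. A \<in> shift i j F \<Longrightarrow> i \<in> A"
  shows "real (card F) * real (card G) \<le> h\<^sup>2"
proof -
  define Y where "Y = X - {i} - {j}"
  have Y: "finite Y" "card Y = l + r" using X ij by (auto simp: Y_def)
  obtain l' where l': "l = Suc l'" using lr by (cases l) auto
  obtain r' where r': "r = Suc r'" using lr by (cases r) auto
  define F12 F1 F2 where "F12 = link (link F i) j" and "F1 = deletion (link F i) j"
    and "F2 = link (deletion F i) j"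
  define G12 G1 G2 G0 where "G12 = link (link G i) j" and "G1 = deletion (link G i) j"
    and "G2 = link (deletion G i) j" and "G0 = deletion (deletion G i) j"
  note defs = F12_def F1_def F2_def G12_def G1_def G2_def G0_def
  have u: "F12 \<subseteq> uniform Y l'" "F1 \<subseteq> uniform Y l" "F2 \<subseteq> uniform Y l"
    "G12 \<subseteq> uniform Y l'" "G1 \<subseteq> uniform Y l" "G2 \<subseteq> uniform Y l" "G0 \<subseteq> uniform Y (Suc l)"
    unfolding defs Y_def
    using link_uniform[OF link_uniform[OF F[unfolded l'], of i], of j]
      link_uniform[OF link_uniform[OF G[unfolded l'], of i], of j]
      deletion_uniform[OF link_uniform[OF F, of i], of j] deletion_uniform[OF link_uniform[OF G, of i], of j]
      link_uniform[OF deletion_uniform[OF F, of i], of j] link_uniform[OF deletion_uniform[OF G, of i], of j]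
      deletion_uniform[OF deletion_uniform[OF G, of i], of j]
    by (simp_all only: l')
  have fin: "finite F" "finite G" "finite (link F i)" "finite (deletion F i)" "finite (link G i)" "finite (deletion G i)"
    using finite_uniform[OF X(1) F] finite_uniform[OF X(1) G] by (auto simp: link_def deletion_def)
  have F0: "deletion (deletion F i) j = {}"
  proof (rule ccontr)
    assume "deletion (deletion F i) j \<noteq> {}"
    then obtain A where A: "A \<in> F" "i \<notin> A" "j \<notin> A" by (auto simp: deletion_def)
    then show False using trivial[OF shift_set_in_shift[OF A(1)]] by (simp add: shift_set_def)
  qed
  \<comment> \<open>A common member would give a set of \<open>F\<close> through \<open>j\<close>
    whose image is already in \<open>F\<close>; it would survive the shift without containing
    \<open>i\<close>. Disjointness allows \<open>F1\<close> and \<open>F2\<close> to be bounded as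
    one \<open>l\<close>-uniform family.\<close>
  have disj: "F1 \<inter> F2 = {}"
  proof (rule ccontr)
    assume "F1 \<inter> F2 \<noteq> {}"
    then obtain A B where AB: "A \<in> F" "i \<in> A" "B \<in> F" "i \<notin> B" "j \<in> B" "A - {i} = B - {j}" "j \<notin> A - {i}"
      by (auto simp: defs link_def deletion_def)
    then have "shift_set i j B = A" by (auto simp: shift_set_def)
    then have "B \<in> shift i j F" using AB by (simp add: shift_def)
    then show False using trivial AB by blast
  qed
  have sF: "card F = card F12 + card F1 + card F2"
    using card_link_deletion[OF fin(1), of i] card_link_deletion[OF fin(3), of j]
      card_link_deletion[OF fin(4), of j] F0 unfolding defs by simp
  have sG: "card G = card G12 + card G1 + card G2 + card G0"
    using card_link_deletion[OF fin(2), of i] card_link_deletion[OF fin(5), of j]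
      card_link_deletion[OF fin(6), of j] unfolding defs by simp
  have cross: "cross_intersecting F1 G2" "cross_intersecting F2 G1" "cross_intersecting F12 G0"
    "cross_intersecting (F1 \<union> F2) G0"
    using c unfolding cross_intersecting_def defs link_def deletion_def by blast+
  have F1_ne: "F1 \<noteq> {}"
  proof -
    obtain A where A: "A \<in> F" "j \<notin> A" using nF unfolding non_trivial_iff by blast
    then have "i \<in> A" using F0 by (auto simp: deletion_def)
    then have "A - {i} \<in> F1" using A by (auto simp: defs link_def deletion_def)
    then show ?thesis by blast
  qed
  have F2_ne: "F2 \<noteq> {}"
  proof -
    obtain A where A: "A \<in> F" "i \<notin> A" using nF unfolding non_trivial_iff by blast
    then have "j \<in> A" using F0 by (auto simp: deletion_def)
    then have "A - {j} \<in> F2" using A by (auto simp: defs link_def deletion_def)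
    then show ?thesis by blast
  qed
  have S_split: "real (l + r choose l') = S - R"
    using choose_l_minus_1(1) l' by simp
  have sizes12: "real (card G12) \<le> S - R"
  proof -
    have "card G12 \<le> l + r choose l'"
      using card_mono[OF finite_uniform[OF Y(1) subset_refl] u(4)] card_uniform[OF Y(1)] Y(2) by simp
    then show ?thesis unfolding S_split[symmetric] by simp
  qed
  define A B where "A = link (shift i j F) i" and "B = deletion (shift i j G) i"
  have shu: "shift i j F \<subseteq> uniform X (Suc l)" "shift i j G \<subseteq> uniform X (Suc l)"
    by (rule shift_uniform[OF F X(1) ij(1)], rule shift_uniform[OF G X(1) ij(1)])
  have Au: "A \<subseteq> uniform (X - {i}) l" and Bu: "B \<subseteq> uniform (X - {i}) (Suc l)"
    unfolding A_def B_def using link_uniform[OF shu(1)] deletion_uniform[OF shu(2)] by auto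
  have AB: "cross_intersecting A B"
    unfolding A_def B_def by (rule cross_link_deletion[OF shift_cross_intersecting[OF c]])
  have X': "finite (X - {i})" "card (X - {i}) = Suc (l + r)" using X ij by auto
  have cA: "card A = card F"
  proof -
    have "{C \<in> shift i j F. i \<in> C} = shift i j F" using trivial by blast
    then show ?thesis unfolding A_def card_link by (simp add: card_shift)
  qed
  have G0B: "G0 \<subseteq> B"
    by (auto simp: G0_def B_def deletion_def shift_def shift_set_def)
  show ?thesis
  \<comment> \<open>The threshold is the limit of the sum bound for \<open>F12\<close> and
    \<open>G0\<close>, whose parameters on \<open>n - 2\<close> elements are \<open>l - 1\<close>
    and \<open>r - 1\<close>. Beyond it \<open>G0\<close> makes \<open>F\<close> so small that a
    crude bound on the link of the shifted \<open>G\<close> suffices.\<close>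
  proof (cases "card G0 \<le> l + r - 2 choose (l - 1)")
    case False
    have sym: "l + r - 2 choose r' = l + r - 2 choose l'"
      using binomial_symmetric[of r' "l + r - 2"] l' r' by simp
    have idx: "r' = card Y - Suc l" "l' \<le> r'" "l \<le> r'" "r' \<le> l + r - 2" using Y(2) l' r' lr by auto
    have G0_large: "l + r - 2 choose r' \<le> card G0" using False l' unfolding sym by simp
    have u12: "F1 \<union> F2 \<subseteq> uniform Y l" using u(2,3) by (rule Un_least)
    have "card F12 + (l + r - 2 choose l') \<le> card Y choose l'"
      by (rule cross_large_bound[OF u(1,7) Y(1) cross(3) idx(1,2,4) G0_large])
    moreover have "card (F1 \<union> F2) + (l + r - 2 choose l) \<le> card Y choose l"
      by (rule cross_large_bound[OF u12 u(7) Y(1) cross(4) idx(1,3,4) G0_large])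
    moreover have "card (F1 \<union> F2) = card F1 + card F2"
      by (rule card_Un_disjoint[OF finite_uniform[OF Y(1) u(2)] finite_uniform[OF Y(1) u(3)] disj])
    moreover have "(l + r - 2 choose l') + (l + r - 2 choose l) = l + r - 1 choose l"
      using l' r' by simp
    ultimately have "card F + (l + r - 1 choose l) \<le> (l + r choose l') + (l + r choose l)"
      using sF unfolding Y(2) by linarith
    then have f: "real (card F) \<le> S - (l + r - 1 choose l)"
      using S_split unfolding R_def by linarith
    have "card (link (shift i j G) i) \<le> Suc (l + r) choose l"
      using card_mono[OF finite_uniform[OF X'(1) subset_refl] link_uniform[OF shu(2), of i]] card_uniform[OF X'(1)] X' finite_uniform[OF X'(1)] by simp
    then have g1: "real (card (link (shift i j G) i)) \<le> S" unfolding S_def by simp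
    have "card G = card (link (shift i j G) i) + card B"
      using card_link_deletion[OF finite_uniform[OF X(1) shu(2)], of i] by (simp add: card_shift B_def)
    then have "real (card F) * real (card G) = card F * real (card (link (shift i j G) i)) + real (card A) * card B"
      by (simp add: cA algebra_simps)
    also have "\<dots> \<le> (S - (l + r - 1 choose l)) * S + Q"
      using f g1 product_bound[OF Au Bu X'(1) AB X'(2)]
      by (intro add_mono mult_mono) (auto intro: order_trans[OF _ f])
    finally show ?thesis using trivial_bound by simp
  next
    case G0: True
    then have "real (card G0) \<le> real (l + r - 2 choose (l - 1))" by (simp only: of_nat_le_iff)
    then have G0T: "real (card G0) \<le> \<alpha> * R" using small_threshold by linarith
    have single: "real (card C) \<le> R - E"
      if "C \<subseteq> uniform Y l" "D \<subseteq> uniform Y l" "cross_intersecting C D" "D \<noteq> {}" for C D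
    proof -
      have "1 \<le> card D" using that(2,4) finite_uniform[OF Y(1) that(2)] by (simp add: Suc_leI card_gt_0_iff)
      then have "card C + (r choose l) \<le> card Y choose l"
        using cross_large_bound[OF that(1,2) Y(1) that(3), of r r] Y(2) lr by simp
      then show ?thesis unfolding R_def E_def using Y(2) by simp
    qed
    show ?thesis
    \<comment> \<open>The pair bounds need nonempty families. If \<open>G1\<close> or
      \<open>G2\<close> is empty, non-triviality makes \<open>G0\<close> nonempty, and the excess
      bound for all of \<open>F\<close> against \<open>G0\<close> replaces them.\<close>
    proof (cases "G1 = {} \<or> G2 = {}")
      case True
      have "G0 \<noteq> {}"
      proof
        assume e: "G0 = {}"
        from True show False
        proof
          assume "G1 = {}"
          then have "j \<in> C" if "C \<in> G" for C
            using that e ij by (auto simp: defs link_def deletion_def)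
          then show False using nG unfolding non_trivial_iff by blast
        next
          assume "G2 = {}"
          then have "i \<in> C" if "C \<in> G" for C
            using that e ij by (auto simp: defs link_def deletion_def)
          then show False using nG unfolding non_trivial_iff by blast
        qed
      qed
      moreover have "G0 \<subseteq> uniform (X - {i}) (Suc l)" using G0B Bu by blast
      moreover have "cross_intersecting A G0" using cross_intersecting_mono[OF AB _ G0B] by blast
      ultimately have "real (card A) + real (card G0) \<le> real (card (X - {i}) choose l) - E + 1"
        using excess_bound[OF Au, of G0 "Suc l"] X' G0T by simp
      then have 1: "real (card F) + real (card G0) \<le> h" unfolding cA h_def S_def X'(2) .
      have "real (card G1) + real (card G2) \<le> R - E"
        using True single[OF u(5,3) cross_intersecting_sym[OF cross(2)] F2_ne]
          single[OF u(6,2) cross_intersecting_sym[OF cross(1)] F1_ne] by auto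
      then have "real (card F) + real (card G) \<le> 2 * h" using 1 sG sizes12 unfolding h_def by simp
      then show ?thesis by (intro mult_le_square_of_sum) auto
    next
      case False
      have pair: "real (card C) + real (card D) \<le> R - E + 1"
        if CD: "C \<subseteq> uniform Y l" "D \<subseteq> uniform Y l" "cross_intersecting C D" "C \<noteq> {}" "D \<noteq> {}" for C D
      proof -
        have rY: "r = card Y - l" using Y(2) by simp
        \<comment> \<open>The third range is where \<open>\<alpha> >= 1/2\<close> enters: two
          families above \<open>\<alpha> * R\<close> would together exceed \<open>R\<close>, against
          the sum bound.\<close>
        consider "card D \<le> \<alpha> * R" | "card C \<le> \<alpha> * R" | "\<alpha> * R < card C" "\<alpha> * R < card D" by linarith
        then show ?thesis
        proof cases
          case 1
          then show ?thesis using excess_bound[OF CD(1,2) Y(1) CD(3) rY CD(5)] Y(2) by (simp add: R_def)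
        next
          case 2
          then show ?thesis
            using excess_bound[OF CD(2,1) Y(1) cross_intersecting_sym[OF CD(3)] rY CD(4)] Y(2) by (simp add: R_def)
        next
          case 3
          have "card D \<le> l + r choose l"
            using card_mono[OF finite_uniform[OF Y(1) subset_refl] CD(2)] card_uniform[OF Y(1)] finite_uniform[OF Y(1)] Y(2) by simp
          then have "card C + card D \<le> l + r choose l"
            using cross_small_bound[OF CD(1,2) Y(1) CD(3) rY] Y(2) lr by simp
          then have "real (card C) + real (card D) \<le> R" unfolding R_def by linarith
          moreover have "R \<le> \<alpha> * R + \<alpha> * R" using mult_right_mono[OF \<alpha>(1), of R] R_pos by simp
          ultimately show ?thesis using 3 by linarith
        qed
      qed
      have "card F12 + card G0 \<le> card Y choose l'"
        by (rule cross_small_bound[OF u(1,7) Y(1) cross(3), of r']) (use G0 Y(2) l' r' lr in auto)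
      then have "real (card F12) + real (card G0) \<le> S - R" using S_split Y(2) by simp
      then have "real (card F) + real (card G) \<le> 2 * h"
        using pair[OF u(2,6) cross(1) F1_ne] pair[OF u(3,5) cross(2) F2_ne] False sizes12 sF sG
        unfolding h_def by simp
      then show ?thesis by (intro mult_le_square_of_sum) auto
    qed
  qed
qed

theorem non_trivial_product_bound:
  assumes F: "F \<subseteq> uniform {1..n} (Suc l)" and G: "G \<subseteq> uniform {1..n} (Suc l)"
    and n: "n = Suc (Suc (l + r))" and c: "cross_intersecting F G"
    and nF: "non_trivial F" and nG: "non_trivial G"
  shows "real (card F) * real (card G) \<le> h\<^sup>2"
proof -
  \<comment> \<open>The pair is taken of least total weight among the non-trivial cross-intersecting
    pairs of the same sizes. A shift that changes it must then destroy non-triviality.\<close>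
  define P where "P F' G' \<longleftrightarrow> F' \<subseteq> uniform {1..n} (Suc l) \<and> G' \<subseteq> uniform {1..n} (Suc l) \<and>
    cross_intersecting F' G' \<and> non_trivial F' \<and> non_trivial G' \<and> card F' = card F \<and> card G' = card G"
    for F' G'
  have "P F G" using assms by (simp add: P_def)
  then have "\<exists>p. P (fst p) (snd p) \<and>
      (\<forall>q. P (fst q) (snd q) \<longrightarrow> weight (fst p) + weight (snd p) \<le> weight (fst q) + weight (snd q))"
    by (intro ex_has_least_nat[of _ "(F, G)"]) simp
  then obtain F' G' where P: "P F' G'"
    and min: "\<And>F'' G''. P F'' G'' \<Longrightarrow> weight F' + weight G' \<le> weight F'' + weight G''"
    by auto
  have F': "F' \<subseteq> uniform {1..n} (Suc l)" and G': "G' \<subseteq> uniform {1..n} (Suc l)"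
    and c': "cross_intersecting F' G'" and nF': "non_trivial F'" and nG': "non_trivial G'"
    and sizes: "card F' = card F" "card G' = card G"
    using P unfolding P_def by auto
  have X: "finite {1..n}" "card {1..n} = Suc (Suc (l + r))" using n by auto
  have fin: "finite F'" "finite G'" using finite_uniform[OF X(1)] F' G' by blast+
  have finA: "finite A" if "A \<in> F' \<or> A \<in> G'" for A
  proof -
    have "A \<subseteq> {1..n}" using that F' G' by blast
    then show ?thesis using finite_subset[OF _ X(1)] by simp
  qed
  have "real (card F') * real (card G') \<le> h\<^sup>2"
  proof (cases "shifted n F' \<and> shifted n G'")
    case False
    then obtain i j where ij: "1 \<le> i" "i < j" "j \<le> n" and ne: "shift i j F' \<noteq> F' \<or> shift i j G' \<noteq> G'"
      unfolding shifted_def by blast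
    have ijX: "i \<in> {1..n}" "j \<in> {1..n}" "i \<noteq> j" using ij by auto
    let ?F = "shift i j F'" and ?G = "shift i j G'"
    have "weight ?F + weight ?G < weight F' + weight G'"
      using weight_shift[OF fin(1) finA ij(2)] weight_shift[OF fin(2) finA ij(2)] ne by fastforce
    then have "\<not> P ?F ?G" using min[of ?F ?G] by linarith
    moreover have "?F \<subseteq> uniform {1..n} (Suc l)" "?G \<subseteq> uniform {1..n} (Suc l)"
      using shift_uniform[OF F' X(1) ijX(1)] shift_uniform[OF G' X(1) ijX(1)] by auto
    ultimately have "\<not> non_trivial ?F \<or> \<not> non_trivial ?G"
      using shift_cross_intersecting[OF c'] sizes unfolding P_def by (simp add: card_shift)
    then show ?thesis
    proof
      assume "\<not> non_trivial ?F"
      then obtain x where x: "\<And>A. A \<in> ?F \<Longrightarrow> x \<in> A" unfolding non_trivial_iff by blast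
      have "x = i"
      proof (rule ccontr)
        assume "x \<noteq> i"
        then show False using shift_common_element[OF x] nF' unfolding non_trivial_iff by blast
      qed
      then show ?thesis using trivial_shift_bound[OF F' G' X ijX c' nF' nG'] x by blast
    next
      assume "\<not> non_trivial ?G"
      then obtain x where x: "\<And>A. A \<in> ?G \<Longrightarrow> x \<in> A" unfolding non_trivial_iff by blast
      have "x = i"
      proof (rule ccontr)
        assume "x \<noteq> i"
        then show False using shift_common_element[OF x] nG' unfolding non_trivial_iff by blast
      qed
      then show ?thesis
        using trivial_shift_bound[OF G' F' X ijX cross_intersecting_sym[OF c'] nG' nF'] x
        by (simp add: mult.commute)
    qed
  next
    case True
    \<comment> \<open>Compression towards 1 is required for every \<open>j\<close> of the ground
      set, including \<open>j = 1\<close>, where the shift is the identity.\<close>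
    have sh: "shift 1 j H = H" if "shifted n H" "j \<in> {1..n}" for j H
    proof (cases "j = 1")
      case True
      have "shift_set 1 1 A = A" for A :: "nat set" by (auto simp: shift_set_def)
      then show ?thesis unfolding True shift_def by auto
    next
      case False
      then show ?thesis using that unfolding shifted_def by auto
    qed
    have one: "1 \<in> {1..n}" using n by simp
    have Y: "finite ({1..n} - {1})" "card ({1..n} - {1}) = Suc (l + r)" using n by auto
    have walk: "card (deletion F' 1) * card (deletion G' 1) \<le> (Suc (l + r) choose (l - 1))\<^sup>2"
      using shifted_deletion_product[of n "Suc l" F' G'] True F' G' c' n lr by simp
    have ne: "deletion F' 1 \<noteq> {}" "deletion G' 1 \<noteq> {}"
      using nF' nG' unfolding non_trivial_iff deletion_def by blast+
    consider "card (deletion F' 1) \<le> \<alpha> * R" "card (deletion G' 1) \<le> \<alpha> * R"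
      | "\<alpha> * R < card (deletion F' 1)" "card (deletion G' 1) \<le> card (deletion F' 1)"
      | "\<alpha> * R < card (deletion G' 1)" "card (deletion F' 1) \<le> card (deletion G' 1)"
      by linarith
    then show ?thesis
    proof cases
      case 1
      have rY: "r = card ({1..n} - {1}) - Suc l" using Y(2) by simp
      have "real (card (link F' 1)) + real (card (deletion G' 1)) \<le> h"
        using excess_bound[OF link_uniform[OF F'] deletion_uniform[OF G'] Y(1) cross_link_deletion[OF c'] rY ne(2) 1(2)]
        unfolding h_def S_def Y(2) .
      moreover have "real (card (link G' 1)) + real (card (deletion F' 1)) \<le> h"
        using excess_bound[OF link_uniform[OF G'] deletion_uniform[OF F'] Y(1)
          cross_link_deletion[OF cross_intersecting_sym[OF c']] rY ne(1) 1(1)]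
        unfolding h_def S_def Y(2) .
      ultimately have "real (card F') + real (card G') \<le> 2 * h"
        using card_link_deletion[OF fin(1), of 1] card_link_deletion[OF fin(2), of 1] by simp
      then show ?thesis by (intro mult_le_square_of_sum) auto
    next
      case 2
      show ?thesis
        by (rule compressed_bound[OF F' G' X(1) one X(2) c' sh sh 2(2,1) walk]) (use True in auto)
    next
      case 3
      have "real (card G') * real (card F') \<le> h\<^sup>2"
        by (rule compressed_bound[OF G' F' X(1) one X(2) cross_intersecting_sym[OF c'] sh sh 3(2,1)])
          (use True walk in \<open>auto simp: mult.commute\<close>)
      then show ?thesis by (simp add: mult.commute)
    qed
  qed
  then show ?thesis by (simp add: sizes)
qed

end

section \<open>The parameter inequalities\<close>

text \<open>The factors \<open>(r - i) / (N - i)\<close> are paired symmetrically about the middle.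
  With midpoints \<open>A < B\<close> of numerators and denominators,
  \<open>(A^2 - t^2) / (B^2 - t^2) <= A^2 / B^2\<close>, so the product is at most the
  \<open>l\<close>-th power of the middle ratio.\<close>

lemma choose_ratio_bound:
  assumes "l \<le> r"
  shows "real (r choose l) \<le> ((2 * real r - real l + 1) / (2 * real r + real l + 3)) ^ l * real (Suc (l + r) choose l)"
proof -
  define N where "N = real (Suc (l + r))"
  define u where "u i = (real r - real i) / (N - real i)" for i
  define A where "A = real r - (real l - 1) / 2"
  define B where "B = N - (real l - 1) / 2"
  have AB: "0 < A" "A < B" using assms by (auto simp: A_def B_def N_def field_simps)
  have pos: "0 \<le> u i" if "i < l" for i using that assms by (auto simp: u_def N_def)
  have pair: "u i * u (l - Suc i) \<le> (A / B)\<^sup>2" if i: "i < l" for i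
  proof -
    define t where "t = real i - (real l - 1) / 2"
    have rev: "real (l - Suc i) = real l - 1 - real i" using i by simp
    have eq: "real r - real i = A - t" "real r - real (l - Suc i) = A + t"
      "N - real i = B - t" "N - real (l - Suc i) = B + t"
      unfolding rev A_def B_def t_def by (simp_all add: field_simps)
    have "0 < N - real i" "0 < N - real (l - Suc i)" using i by (auto simp: N_def)
    then have pB: "0 < (B - t) * (B + t)" unfolding eq by simp
    have "t\<^sup>2 * A\<^sup>2 \<le> t\<^sup>2 * B\<^sup>2" using AB by (intro mult_left_mono power_mono) auto
    then have "(A - t) * (A + t) * B\<^sup>2 \<le> A\<^sup>2 * ((B - t) * (B + t))"
      by (simp add: algebra_simps power2_eq_square)
    then have "(A - t) * (A + t) / ((B - t) * (B + t)) \<le> A\<^sup>2 / B\<^sup>2"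
      using pB AB by (simp add: divide_simps)
    then show ?thesis unfolding u_def eq by (simp add: power_divide)
  qed
  have "(\<Prod>i<l. u i)\<^sup>2 = (\<Prod>i<l. u i) * (\<Prod>i<l. u (l - Suc i))"
    unfolding prod.nat_diff_reindex by (rule power2_eq_square)
  also have "\<dots> = (\<Prod>i<l. u i * u (l - Suc i))" by (rule prod.distrib[symmetric])
  also have "\<dots> \<le> (\<Prod>i<l. (A / B)\<^sup>2)" using pair pos by (intro prod_mono) auto
  also have "\<dots> = ((A / B) ^ l)\<^sup>2" by (simp add: power_even_eq[symmetric] flip: power_mult) (simp add: mult.commute)
  finally have "(\<Prod>i<l. u i) \<le> (A / B) ^ l" by (rule power2_le_imp_le) (use AB in simp)
  moreover have "real (r choose l) = (\<Prod>i<l. u i) * real (Suc (l + r) choose l)"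
  proof -
    have "(\<Prod>i<l. real r - real i) = (\<Prod>i<l. u i) * (\<Prod>i<l. N - real i)"
      unfolding u_def prod.distrib[symmetric] by (intro prod.cong) (auto simp: N_def)
    then show ?thesis
      unfolding binomial_gbinomial gbinomial_prod_rev N_def by (simp add: atLeast0LessThan del: of_nat_Suc)
  qed
  moreover have "A / B = (2 * real r - real l + 1) / (2 * real r + real l + 3)"
    using AB by (simp add: A_def B_def N_def field_simps)
  ultimately show ?thesis by (simp add: mult_right_mono del: binomial_Suc_Suc)
qed

text \<open>All quantities are divided by \<open>S\<close> (or by \<open>S\<^sup>2\<close>), which leaves rational functions of \<open>k\<close> and
  \<open>v = n - k\<close>; \<open>e\<close> is an upper bound for \<open>(r choose l) / S\<close>.\<close>

lemma hm_parametersI: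
  fixes l r :: nat and k v x \<kappa> \<alpha> e w :: real
  assumes k: "k = real l + 1" and v: "v = real r + 1"
    and x: "x = v / (v + k - 1)" and \<kappa>: "\<kappa> = x\<^sup>2 * ((k - 1) * v / ((v - 1) * (v + 1)))"
    and w: "w = (if r \<le> 2 * l + 1 then k / (v - 1) * \<kappa> else ((k - 1) / (v + 1))\<^sup>2)"
    and lr: "3 \<le> l" "l < r" and \<alpha>: "1 / 2 \<le> \<alpha>" "\<alpha> < 1" and e1: "e \<le> 1"
    and e: "((2 * v - k) / (2 * v + k)) ^ l \<le> e"
    and e\<alpha>: "e \<le> \<alpha> * (1 - \<alpha>) * ((v - k) / (v - 1)) * x"
    and trivial: "1 - x * ((v - 1) / (v + k - 2)) + \<kappa> \<le> (1 - e)\<^sup>2"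
    and balanced: "r \<le> 2 * l + 1 \<Longrightarrow> \<kappa> * (1 + k / (v - 1))\<^sup>2 / (k / (v - 1)) \<le> (1 - e)\<^sup>2"
    and w_le: "2 * w \<le> \<alpha> * x" and \<kappa>_le: "\<kappa> \<le> (\<alpha> * x)\<^sup>2"
    and unbalanced: "(\<kappa> + w) * (1 + 1 / (\<alpha> * x) - w / (\<alpha> * x)\<^sup>2) \<le> (1 - e)\<^sup>2"
  shows "hm_parameters l r \<alpha>"
proof -
  define S R E where "S = real (Suc (l + r) choose l)" and "R = real (l + r choose l)" and "E = real (r choose l)"
  define Q where "Q = R\<^sup>2 * (real l * (real r + 1) / (real r * (real r + 2)))"
  define W where "W = (if r \<le> 2 * l + 1 then (real l + 1) / real r * Q else (real (Suc (l + r) choose (l - 1)))\<^sup>2)"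
  have Spos: "0 < S" by (simp add: S_def)
  have xpos: "0 < x" using lr unfolding x k v by simp
  obtain l' where l': "l = Suc l'" using lr by (cases l) auto
  have R: "R = x * S"
  proof -
    have "(Suc (l + r) - l) * (Suc (l + r) choose l) = Suc (l + r) * (l + r choose l)"
      using binomial_absorb_comp[of "Suc (l + r)" l] by simp
    then have "real (Suc r) * S = real (Suc (l + r)) * R"
      unfolding S_def R_def by (simp only: of_nat_mult[symmetric] of_nat_eq_iff) simp
    then show ?thesis unfolding x v k by (simp add: field_simps)
  qed
  have Q: "Q = \<kappa> * S\<^sup>2"
    unfolding Q_def R \<kappa> k v by (simp add: power_mult_distrib add_ac)
  have W: "W = w * S\<^sup>2"
  proof (cases "r \<le> 2 * l + 1")
    case True
    then show ?thesis unfolding W_def w Q k v by simp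
  next
    case False
    have "(real l' + 1) * S = (real r + 2) * real (Suc (l + r) choose l')"
      using choose_Suc_ratio_real[of l' "Suc (l + r)"] unfolding S_def l' by (simp del: binomial_Suc_Suc)
    then have "real (Suc (l + r) choose (l - 1)) = (k - 1) / (v + 1) * S"
      using l' unfolding k v by (simp add: field_simps del: binomial_Suc_Suc)
    then show ?thesis using False unfolding W_def w by (simp add: power_mult_distrib power_divide del: binomial_Suc_Suc)
  qed
  have E: "E \<le> e * S"
  proof -
    have "E \<le> ((2 * v - k) / (2 * v + k)) ^ l * S"
      using choose_ratio_bound[of l r] lr unfolding E_def S_def k v by (simp add: algebra_simps del: binomial_Suc_Suc)
    also have "\<dots> \<le> e * S" using e Spos by (intro mult_right_mono) auto
    finally show ?thesis .
  qed
  have h: "(1 - e)\<^sup>2 * S\<^sup>2 \<le> (S - E + 1)\<^sup>2"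
    unfolding power_mult_distrib[symmetric] using E e1 Spos by (intro power_mono) (auto simp: algebra_simps)
  have scale: "a * S\<^sup>2 \<le> (S - E + 1)\<^sup>2" if "a \<le> (1 - e)\<^sup>2" for a
    using mult_right_mono[OF that, of "S\<^sup>2"] h by simp
  have M: "l + r \<ge> 2" using lr by simp
  have down: "real (l + r - 1 choose l) = x * ((v - 1) / (v + k - 2)) * S"
  proof -
    have "(l + r - l) * (l + r choose l) = (l + r) * (l + r - 1 choose l)" by (rule binomial_absorb_comp)
    then have "real r * R = real (l + r) * real (l + r - 1 choose l)"
      unfolding R_def by (simp only: of_nat_mult[symmetric] of_nat_eq_iff) simp
    then show ?thesis using lr unfolding R k v by (simp add: field_simps)
  qed
  show ?thesis
  proof (unfold_locales, fold S_def R_def E_def, fold Q_def, fold W_def)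
    show "3 \<le> l" "l < r" "1 / 2 \<le> \<alpha>" "\<alpha> < 1" by fact+
    have "E \<le> \<alpha> * (1 - \<alpha>) * ((v - k) / (v - 1)) * x * S"
      using E mult_right_mono[OF e\<alpha>, of S] Spos by simp
    then show "E \<le> \<alpha> * (1 - \<alpha>) * (1 - real l / real r) * R"
      using lr unfolding R k v by (simp add: diff_divide_distrib mult.assoc)
    \<comment> \<open>The binomial on the left is \<open>R\<close> times
      \<open>l * r / ((l + r) * (l + r - 1))\<close>, a factor of at most one half.\<close>
    show "real (l + r - 2 choose (l - 1)) \<le> \<alpha> * R"
    proof -
      have "l * (l + r choose l) = (l + r) * (l + r - 1 choose (l - 1))"
        using times_binomial_minus1_eq[of l "l + r"] lr by simp
      moreover have "r * (l + r - 1 choose (l - 1)) = (l + r - 1) * (l + r - 2 choose (l - 1))"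
        using binomial_absorb_comp[of "l + r - 1" "l - 1"] lr by (simp add: numeral_2_eq_2)
      ultimately have "(l + r) * ((l + r - 1) * (l + r - 2 choose (l - 1))) = l * r * (l + r choose l)"
        by (metis mult.assoc mult.commute)
      then have eq: "real (l + r) * real (l + r - 1) * real (l + r - 2 choose (l - 1)) = real l * real r * R"
        unfolding R_def by (simp only: of_nat_mult[symmetric] of_nat_eq_iff mult.assoc)
      have "2 * (real l * real r) \<le> real (l + r) * real (l + r - 1)"
      proof -
        have "real (l + r) \<le> real l * real l + real r * real r"
          using lr by (simp) (intro add_mono, auto)
        then show ?thesis using M by (simp add: of_nat_diff algebra_simps)
      qed
      then have "2 * (real l * real r) * R \<le> real (l + r) * real (l + r - 1) * R"
        by (intro mult_right_mono) (auto simp: R_def)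
      then have "real (l + r) * real (l + r - 1) * (2 * real (l + r - 2 choose (l - 1))) \<le> real (l + r) * real (l + r - 1) * R"
        using eq by (simp only: mult.assoc mult.left_commute[of _ 2])
      moreover have "0 < real (l + r) * real (l + r - 1)" using M by simp
      ultimately have "2 * real (l + r - 2 choose (l - 1)) \<le> R" by (rule mult_left_le_imp_le)
      moreover have "1 / 2 * R \<le> \<alpha> * R" using \<alpha> by (intro mult_right_mono) (auto simp: R_def)
      ultimately show ?thesis by linarith
    qed
    show "(S - real (l + r - 1 choose l)) * S + Q \<le> (S - E + 1)\<^sup>2"
      using scale[OF trivial] unfolding down Q by (simp add: algebra_simps power2_eq_square)
    show "Q * (1 + (real l + 1) / real r)\<^sup>2 / ((real l + 1) / real r) \<le> (S - E + 1)\<^sup>2" if "r \<le> 2 * l + 1"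
      using scale[OF balanced[OF that]] unfolding Q k v by (simp add: mult_ac)
    show "2 * W \<le> S * (\<alpha> * R)"
      using mult_right_mono[OF w_le, of "S\<^sup>2"] unfolding W R by (simp add: power2_eq_square mult_ac)
    show "Q \<le> (\<alpha> * R)\<^sup>2"
      using mult_right_mono[OF \<kappa>_le, of "S\<^sup>2"] unfolding Q R by (simp add: power_mult_distrib mult_ac)
    have "S / (\<alpha> * R) = 1 / (\<alpha> * x)" "W / (\<alpha> * R)\<^sup>2 = w / (\<alpha> * x)\<^sup>2"
      using Spos unfolding W R by (auto simp: power_mult_distrib)
    moreover have "Q + W = (\<kappa> + w) * S\<^sup>2" by (simp add: Q W distrib_right)
    ultimately show "(Q + W) * (1 + S / (\<alpha> * R) - W / (\<alpha> * R)\<^sup>2) \<le> (S - E + 1)\<^sup>2"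
      using scale[OF unbalanced] by (simp only: mult_ac)
  qed
qed

text \<open>In the variables \<open>i = k - 2\<close> and \<open>j = v - k - 1\<close> the difference of the two sides has
  nonnegative coefficients only.\<close>

lemma large_k_inequalities:
  fixes k v :: real
  assumes "2 \<le> k" "k + 1 \<le> v"
  shows "4 * k\<^sup>2 * (v ^ 3 * (k - 1) * ((v - 1)\<^sup>2 * (v + 1)) * (k + 1)\<^sup>2
      + v\<^sup>2 * (v + k - 1) * k\<^sup>2 * (k + 1) * ((v - 1)\<^sup>2 * (v + 1)) - v ^ 4 * k ^ 5)
    \<le> (4 * k\<^sup>2 - 1) * ((v + k - 1) * ((v - 1)\<^sup>2 * (v + 1))\<^sup>2 * (k + 1)\<^sup>2)" (is ?unbalanced)
    and "(v + k - 1)\<^sup>2 * (v + k - 2) * (v\<^sup>2 - 1)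
      \<le> (v * (v - 1) * (v + k - 1) * (v\<^sup>2 - 1) - v ^ 3 * (k - 1) * (v + k - 2)) * (4 * k\<^sup>2)" (is ?trivial)
    and "2 * k ^ 3 * v\<^sup>2 \<le> (k + 1) * (v + k - 1) * ((v - 1)\<^sup>2 * (v + 1))" (is ?w)
    and "v * k ^ 4 \<le> (k - 1) * (k + 1)\<^sup>2 * (v\<^sup>2 - 1)" (is ?\<kappa>)
proof -
  define i j where "i = k - 2" and "j = v - k - 1"
  have ij: "0 \<le> i" "0 \<le> j" and k: "k = 2 + i" and v: "v = 3 + i + j"
    using assms by (auto simp: i_def j_def)
  have "0 \<le> 8 * i ^ 9 * j ^ 2 + 36 * i ^ 8 * j ^ 3 + 64 * i ^ 7 * j ^ 4 + 56 * i ^ 6 * j ^ 5 + 24 * i ^ 5 * j ^ 6 + 4 * i ^ 4 * j ^ 7 + 16 * i ^ 9 * j + 264 * i ^ 8 * j ^ 2 + 888 * i ^ 7 * j ^ 3 + 1280 * i ^ 6 * j ^ 4 + 912 * i ^ 5 * j ^ 5 + 312 * i ^ 4 * j ^ 6 + 40 * i ^ 3 * j ^ 7 + 2 * i ^ 9 + 367 * i ^ 8 * j + 3468 * i ^ 7 * j ^ 2 + 9161 * i ^ 6 * j ^ 3 + 10678 * i ^ 5 * j ^ 4 + 6069 * i ^ 4 * j ^ 5 + 1596 * i ^ 3 * j ^ 6 + 147 * i ^ 2 * j ^ 7 + 40 * i ^ 8 + 3694 * i ^ 7 * j + 24848 * i ^ 6 * j ^ 2 + 52166 * i ^ 5 *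 j ^ 3 + 48336 * i ^ 4 * j ^ 4 + 21138 * i ^ 3 * j ^ 5 + 4008 * i ^ 2 * j ^ 6 + 234 * i * j ^ 7 + 366 * i ^ 7 + 21475 * i ^ 6 * j + 109256 * i ^ 5 * j ^ 2 + 180501 * i ^ 4 * j ^ 3 + 128526 * i ^ 3 * j ^ 4 + 40641 * i ^ 2 * j ^ 5 + 4928 * i * j ^ 6 + 135 * j ^ 7 + 2020 * i ^ 6 + 79660 * i ^ 5 * j + 309360 * i ^ 4 * j ^ 2 + 390300 * i ^ 3 * j ^ 3 + 201048 * i ^ 2 * j ^ 4 + 40872 * i * j ^ 5 + 2364 * j ^ 6 + 7412 * i ^ 5 + 195956 * i ^ 4 * j + 568348 * i ^ 3 * j ^ 2 + 516612 * i ^ 2 * j ^ 3 + 171456 * i * j ^ 4 + 16776 * j ^ 5 + 18672 * i ^ 4 + 320272 * i ^ 3 * j + 656688 * i ^ 2 * j ^ 2 + 383552 * i * j ^ 3 + 61520 * j ^ 4 + 32064 * i ^ 3 + 335920 * i ^ 2 * j + 434672 * i * j ^ 2 + 122496 * j ^ 3 + 35904 * i ^ 2 + 205440 * i * j + 125952 * j ^ 2 + 23616 * i + 55872 * j + 6912"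
    using ij by (intro add_nonneg_nonneg mult_nonneg_nonneg zero_le_power) auto
  also have "\<dots> = (4 * k\<^sup>2 - 1) * ((v + k - 1) * ((v - 1)\<^sup>2 * (v + 1))\<^sup>2 * (k + 1)\<^sup>2) - 4 * k\<^sup>2 * (v ^ 3 * (k - 1) * ((v - 1)\<^sup>2 * (v + 1)) * (k + 1)\<^sup>2 + v\<^sup>2 * (v + k - 1) * k\<^sup>2 * (k + 1) * ((v - 1)\<^sup>2 * (v + 1)) - v ^ 4 * k ^ 5)"
    unfolding k v by algebra
  finally show ?unbalanced by simp
  have "0 \<le> 8 * i ^ 6 * j + 28 * i ^ 5 * j ^ 2 + 36 * i ^ 4 * j ^ 3 + 20 * i ^ 3 * j ^ 4 + 4 * i ^ 2 * j ^ 5 + 12 * i ^ 6 + 160 * i ^ 5 * j + 388 * i ^ 4 * j ^ 2 + 360 * i ^ 3 * j ^ 3 + 136 * i ^ 2 * j ^ 4 + 16 * i * j ^ 5 + 160 * i ^ 5 + 1168 * i ^ 4 * j + 2014 * i ^ 3 * j ^ 2 + 1287 * i ^ 2 * j ^ 3 + 296 * i * j ^ 4 + 15 * j ^ 5 + 884 * i ^ 4 + 4216 * i ^ 3 * j + 4989 * i ^ 2 * j ^ 2 + 1972 * i * j ^ 3 + 207 * j ^ 4 + 2600 * i ^ 3 + 8152 * i ^ 2 * j + 5974 * i * j ^ 2 + 1102 * j ^ 3 + 4300 * i ^ 2 + 8128 * i * j + 2792 * j ^ 2 + 3792 * i + 3296 * j + 1392"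
    using ij by (intro add_nonneg_nonneg mult_nonneg_nonneg zero_le_power) auto
  then show ?trivial unfolding k v by (simp add: power_numeral_reduce algebra_simps)
  have "0 \<le> 3 * i ^ 4 * j + 7 * i ^ 3 * j ^ 2 + 5 * i ^ 2 * j ^ 3 + 1 * i * j ^ 4 + 2 * i ^ 4 + 37 * i ^ 3 * j + 59 * i ^ 2 * j ^ 2 + 27 * i * j ^ 3 + 3 * j ^ 4 + 18 * i ^ 3 + 160 * i ^ 2 * j + 160 * i * j ^ 2 + 36 * j ^ 3 + 60 * i ^ 2 + 292 * i * j + 140 * j ^ 2 + 88 * i + 192 * j + 48"
    using ij by (intro add_nonneg_nonneg mult_nonneg_nonneg zero_le_power) auto
  then show ?w unfolding k v by (simp add: power_numeral_reduce algebra_simps)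
  have "0 \<le> 1 * i ^ 4 * j + 1 * i ^ 3 * j ^ 2 + 2 * i ^ 4 + 12 * i ^ 3 * j + 7 * i ^ 2 * j ^ 2 + 17 * i ^ 3 + 48 * i ^ 2 * j + 15 * i * j ^ 2 + 51 * i ^ 2 + 76 * i * j + 9 * j ^ 2 + 62 * i + 38 * j + 24"
    using ij by (intro add_nonneg_nonneg mult_nonneg_nonneg zero_le_power) auto
  then show ?\<kappa> unfolding k v by (simp add: power_numeral_reduce algebra_simps)
qed

text \<open>The right side \<open>1 - 1 / (4 * k^2)\<close> is a lower bound for
  \<open>(1 - e)^2\<close> as soon as \<open>e <= 1 / (8 * k^2)\<close>. The balanced inequality is
  left aside, since its margin is only of order \<open>1 / k^3\<close> when \<open>v - k\<close> is
  bounded.\<close>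

lemma large_k_bounds:
  fixes k v x \<kappa> \<alpha> w :: real
  assumes kv: "2 \<le> k" "k + 1 \<le> v"
    and x: "x = v / (v + k - 1)" and \<kappa>: "\<kappa> = x\<^sup>2 * ((k - 1) * v / ((v - 1) * (v + 1)))"
    and w: "w = k / (v - 1) * \<kappa>" and \<alpha>: "\<alpha> = 1 - 1 / k\<^sup>2"
  shows "1 - x * ((v - 1) / (v + k - 2)) + \<kappa> \<le> 1 - 1 / (4 * k\<^sup>2)"
    and "2 * w \<le> \<alpha> * x"
    and "\<kappa> \<le> (\<alpha> * x)\<^sup>2"
    and "(\<kappa> + w) * (1 + 1 / (\<alpha> * x) - w / (\<alpha> * x)\<^sup>2) \<le> 1 - 1 / (4 * k\<^sup>2)"
proof -
  define m D where "m = v + k - 1" and "D = (v - 1)\<^sup>2 * (v + 1)"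
  have pos: "0 < m" "0 < m - 1" "0 < D" "0 < v" "0 < k" "0 < k - 1" "0 < v - 1" "0 < v\<^sup>2 - 1"
    using kv by (auto simp: m_def D_def power2_eq_square less_1_mult)
  have v2: "(v - 1) * (v + 1) = v\<^sup>2 - 1" by (simp add: algebra_simps power2_eq_square)
  have x': "x = v / m" by (simp add: x m_def)
  have \<alpha>': "\<alpha> = (k - 1) * (k + 1) / k\<^sup>2" using pos by (simp add: \<alpha> field_simps power2_eq_square)
  have \<kappa>': "\<kappa> = v ^ 3 * (k - 1) / (m\<^sup>2 * (v\<^sup>2 - 1))"
    unfolding \<kappa> x' v2 by (simp add: power_divide power2_eq_square power3_eq_cube)
  have D: "D = (v - 1) * (v\<^sup>2 - 1)" unfolding v2[symmetric] by (simp add: D_def power2_eq_square)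
  have w': "w = k * v ^ 3 * (k - 1) / (m\<^sup>2 * D)"
    unfolding w \<kappa>' D by (simp add: mult_ac)
  have \<kappa>w: "\<kappa> + w = v ^ 3 * (k - 1) / (m * D)"
  proof -
    have "\<kappa> = (v - 1) * v ^ 3 * (k - 1) / (m\<^sup>2 * D)" unfolding \<kappa>' D using pos by simp
    then have "\<kappa> + w = (v - 1 + k) * (v ^ 3 * (k - 1)) / (m\<^sup>2 * D)"
      unfolding w' by (simp add: add_divide_distrib[symmetric] distrib_right mult.assoc)
    also have "v - 1 + k = m" by (simp add: m_def)
    finally show ?thesis using pos by (simp add: power2_eq_square)
  qed
  note ineqs = large_k_inequalities[OF kv, folded D_def, folded m_def]
  show "2 * w \<le> \<alpha> * x"
  proof -
    define c where "c = v * (k - 1) / (k\<^sup>2 * m\<^sup>2 * D)"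
    have "0 \<le> c" using pos by (simp add: c_def)
    then have "2 * k ^ 3 * v\<^sup>2 * c \<le> (k + 1) * m * D * c" using ineqs(3) by (intro mult_right_mono)
    moreover have "2 * k ^ 3 * v\<^sup>2 * c = 2 * w"
      unfolding w' c_def using pos by (simp add: power2_eq_square power3_eq_cube)
    moreover have "(k + 1) * m * D * c = \<alpha> * x"
      unfolding \<alpha>' x' c_def using pos by (simp add: power2_eq_square mult_ac)
    ultimately show ?thesis by simp
  qed
  show "\<kappa> \<le> (\<alpha> * x)\<^sup>2"
  proof -
    have "v * k ^ 4 * (v\<^sup>2 * (k - 1)) \<le> (k - 1) * (k + 1)\<^sup>2 * (v\<^sup>2 - 1) * (v\<^sup>2 * (k - 1))"
      using ineqs(4) pos by (intro mult_right_mono) auto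
    then have "v ^ 3 * (k - 1) * k ^ 4 \<le> ((k - 1) * (k + 1) * v)\<^sup>2 * (v\<^sup>2 - 1)"
      by (simp add: algebra_simps power2_eq_square power3_eq_cube)
    then have "v ^ 3 * (k - 1) / (v\<^sup>2 - 1) \<le> ((k - 1) * (k + 1) * v)\<^sup>2 / k ^ 4"
      using pos by (simp add: divide_simps)
    then have "v ^ 3 * (k - 1) / (v\<^sup>2 - 1) / m\<^sup>2 \<le> ((k - 1) * (k + 1) * v)\<^sup>2 / k ^ 4 / m\<^sup>2"
      by (rule divide_right_mono) simp
    moreover have "(\<alpha> * x)\<^sup>2 = ((k - 1) * (k + 1) * v)\<^sup>2 / k ^ 4 / m\<^sup>2"
      unfolding \<alpha>' x' by (simp add: power_divide power_mult_distrib)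
    ultimately show ?thesis unfolding \<kappa>' by (simp add: mult.commute)
  qed
  have m2: "v + k - 2 = m - 1" by (simp add: m_def)
  show "1 - x * ((v - 1) / (v + k - 2)) + \<kappa> \<le> 1 - 1 / (4 * k\<^sup>2)"
  proof -
    define c where "c = v\<^sup>2 - 1"
    have c: "0 < c" using pos by (simp add: c_def)
    have "m\<^sup>2 * (m - 1) * c \<le> (v * (v - 1) * m * c - v ^ 3 * (k - 1) * (m - 1)) * (4 * k\<^sup>2)"
      using ineqs(2) unfolding m2 c_def .
    then have "1 / (4 * k\<^sup>2) \<le> (v * (v - 1) * m * c - v ^ 3 * (k - 1) * (m - 1)) / (m\<^sup>2 * (m - 1) * c)"
      using pos c by (simp add: field_simps)
    also have "\<dots> = v * (v - 1) / (m * (m - 1)) - v ^ 3 * (k - 1) / (m\<^sup>2 * c)"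
      using pos c by (simp add: diff_divide_distrib power2_eq_square)
    finally show ?thesis unfolding x' \<kappa>' m2 c_def by simp
  qed
  show "(\<kappa> + w) * (1 + 1 / (\<alpha> * x) - w / (\<alpha> * x)\<^sup>2) \<le> 1 - 1 / (4 * k\<^sup>2)"
  proof -
    have y: "1 / (\<alpha> * x) = k\<^sup>2 * m / ((k - 1) * (k + 1) * v)"
      unfolding \<alpha>' x' by simp
    have z: "w / (\<alpha> * x)\<^sup>2 = k ^ 5 * v / ((k - 1) * (k + 1)\<^sup>2 * D)"
      unfolding \<alpha>' x' w' using pos
      by (simp add: power_divide power_mult_distrib) (simp add: divide_simps power2_eq_square eval_nat_numeral)
    have "(\<kappa> + w) * (1 + 1 / (\<alpha> * x) - w / (\<alpha> * x)\<^sup>2) =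
      (v ^ 3 * (k - 1) * D * (k + 1)\<^sup>2 + v\<^sup>2 * m * k\<^sup>2 * (k + 1) * D - v ^ 4 * k ^ 5) / (m * D\<^sup>2 * (k + 1)\<^sup>2)"
    proof -
      have "v ^ 3 * (k - 1) / (m * D) * 1 = v ^ 3 * (k - 1) * D * (k + 1)\<^sup>2 / (m * D\<^sup>2 * (k + 1)\<^sup>2)"
        using pos by (simp add: power2_eq_square)
      moreover have "v ^ 3 * (k - 1) / (m * D) * (k\<^sup>2 * m / ((k - 1) * (k + 1) * v)) =
          v\<^sup>2 * m * k\<^sup>2 * (k + 1) * D / (m * D\<^sup>2 * (k + 1)\<^sup>2)"
        using pos by (simp add: divide_simps power2_eq_square power3_eq_cube)
      moreover have "v ^ 3 * (k - 1) / (m * D) * (k ^ 5 * v / ((k - 1) * (k + 1)\<^sup>2 * D)) =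
          v ^ 4 * k ^ 5 / (m * D\<^sup>2 * (k + 1)\<^sup>2)"
        using pos by (simp add: divide_simps power2_eq_square eval_nat_numeral)
      ultimately show ?thesis
        unfolding \<kappa>w y z right_diff_distrib distrib_left diff_divide_distrib add_divide_distrib by (simp only:)
    qed
    also have "\<dots> \<le> (4 * k\<^sup>2 - 1) / (4 * k\<^sup>2)"
    proof -
      have "0 < m * D\<^sup>2 * (k + 1)\<^sup>2" "0 < 4 * k\<^sup>2" using pos by auto
      then show ?thesis using ineqs(1) by (simp add: frac_le_eq divide_le_eq pos_le_divide_eq mult_ac)
    qed
    also have "\<dots> = 1 - 1 / (4 * k\<^sup>2)" using pos by (simp add: diff_divide_distrib)
    finally show ?thesis .
  qed
qed

section \<open>Large \<open>k\<close>: exponential decay against polynomial margins\<close>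

lemma cube_le_power2:
  assumes "15 \<le> l"
  shows "4 * (l + 1) ^ 3 \<le> (2::nat) ^ l"
  using assms
proof (induction l rule: nat_induct_at_least)
  case (Suc l)
  obtain m where l: "l = 15 + m" using Suc.hyps le_Suc_ex by blast
  have "(l + 2) ^ 3 \<le> 2 * (l + 1) ^ 3" unfolding l by (simp add: power3_eq_cube algebra_simps)
  then show ?case using Suc.IH by simp
qed simp

text \<open>The inequality fails at \<open>l = 14\<close>; this sets the border between the general
  argument and the cases checked one by one when \<open>n <= 3 k\<close>.\<close>

lemma square_le_power:
  assumes "15 \<le> l"
  shows "8 * (l + 1)\<^sup>2 * 3 ^ l \<le> (5::nat) ^ l"
  using assms
proof (induction l rule: nat_induct_at_least)
  case (Suc l)
  obtain m where l: "l = 15 + m" using Suc.hyps le_Suc_ex by blast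
  have "3 * (l + 2)\<^sup>2 \<le> 5 * (l + 1)\<^sup>2" unfolding l by (simp add: power2_eq_square algebra_simps)
  then have "8 * (3 * (l + 2)\<^sup>2) * 3 ^ l \<le> 8 * (5 * (l + 1)\<^sup>2) * 3 ^ l" by (intro mult_right_mono mult_left_mono) auto
  also have "\<dots> = 5 * (8 * (l + 1)\<^sup>2 * 3 ^ l)" by simp
  also have "\<dots> \<le> 5 * 5 ^ l" by (rule mult_le_mono2[OF Suc.IH])
  finally show ?case by (simp add: mult_ac)
qed simp

lemma hm_parameters_large_balanced:
  assumes "15 \<le> l" "l < r" "r \<le> 2 * l + 1"
  shows "hm_parameters l r (1 - 1 / (real l + 1)\<^sup>2)"
proof -
  define k v where "k = real l + 1" and "v = real r + 1"
  define d where "d = v - k"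
  have kv: "16 \<le> k" "k + 1 \<le> v" "v \<le> 2 * k" "1 \<le> d" "d \<le> k" "v = k + d"
    using assms by (auto simp: k_def v_def d_def)
  define e where "e = ((2 * v - k) / (2 * v + k)) ^ l"
  have e0: "0 \<le> e" using kv by (simp add: e_def)
  have k3: "k ^ 3 = k\<^sup>2 * k" by (simp add: power3_eq_cube power2_eq_square)
  have "real (4 * (l + 1) ^ 3) \<le> real (2 ^ l)" using cube_le_power2[OF assms(1)] by (simp only: of_nat_le_iff)
  then have two: "4 * k ^ 3 \<le> 2 ^ l" by (simp add: k_def add.commute)
  have "real (8 * (l + 1)\<^sup>2 * 3 ^ l) \<le> real (5 ^ l)" using square_le_power[OF assms(1)] by (simp only: of_nat_le_iff)
  then have five: "8 * k\<^sup>2 * 3 ^ l \<le> 5 ^ l" by (simp add: k_def add.commute)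
  \<comment> \<open>The first bound is half of the balanced margin \<open>d / (2 * k^3)\<close>, as
    \<open>(1 - e)^2 >= 1 - 2 * e\<close>; the second serves the other inequalities. The base of the
    power is at most 1/2 for \<open>v <= 3 k / 2\<close> and at most 3/5 for
    \<open>v <= 2 k\<close>.\<close>
  have e: "e \<le> d / (4 * k ^ 3) \<and> e \<le> 1 / (8 * k\<^sup>2)"
  proof (cases "2 * d \<le> k")
    case True
    have "e \<le> (1 / 2) ^ l"
      unfolding e_def using kv True by (intro power_mono) (auto simp: divide_simps)
    also have "\<dots> = 1 / 2 ^ l" by (simp add: power_one_over)
    also have "\<dots> \<le> 1 / (4 * k ^ 3)" using two kv by (intro divide_left_mono) auto
    finally have *: "e \<le> 1 / (4 * k ^ 3)" .
    have "1 / (4 * k ^ 3) \<le> d / (4 * k ^ 3)" using kv by (intro divide_right_mono) auto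
    moreover have "1 / (4 * k ^ 3) \<le> 1 / (8 * k\<^sup>2)"
      using kv unfolding k3 by (intro divide_left_mono) auto
    ultimately show ?thesis using * by linarith
  next
    case False
    have "e \<le> (3 / 5) ^ l"
      unfolding e_def using kv by (intro power_mono) (auto simp: divide_simps)
    also have "\<dots> \<le> 1 / (8 * k\<^sup>2)" using five kv by (simp add: power_divide divide_simps mult_ac)
    finally have *: "e \<le> 1 / (8 * k\<^sup>2)" .
    have "1 / (8 * k\<^sup>2) = (k / 2) / (4 * k ^ 3)" unfolding k3 using kv by simp
    also have "\<dots> \<le> d / (4 * k ^ 3)" using False kv by (intro divide_right_mono) auto
    finally show ?thesis using * by linarith
  qed
  have e_small: "1 - 1 / (4 * k\<^sup>2) \<le> (1 - e)\<^sup>2"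
  proof -
    have "1 - 2 * e \<le> (1 - e)\<^sup>2" by (simp add: power2_eq_square algebra_simps)
    then show ?thesis using e by simp
  qed
  have k2: "256 \<le> k\<^sup>2" using kv power_mono[of 16 k 2] by simp
  have kk: "0 < 1 / k\<^sup>2" "1 / k\<^sup>2 \<le> 1 / 256" using frac_le[of 1 1 256 "k\<^sup>2"] k2 kv by auto
  note bounds = large_k_bounds[OF _ kv(2) refl refl refl refl]
  show ?thesis unfolding k_def[symmetric]
  proof (rule hm_parametersI[OF k_def v_def refl refl refl])
    show "3 \<le> l" "l < r" using assms by auto
    show "1 / 2 \<le> 1 - 1 / k\<^sup>2" "1 - 1 / k\<^sup>2 < 1" using kk by linarith+
    have "1 / (8 * k\<^sup>2) \<le> 1 / 1" using frac_le[of 1 1 1 "8 * k\<^sup>2"] k2 by auto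
    then show "e \<le> 1" using e by linarith
    show "((2 * v - k) / (2 * v + k)) ^ l \<le> e" by (simp add: e_def)
    show "e \<le> (1 - 1 / k\<^sup>2) * (1 - (1 - 1 / k\<^sup>2)) * ((v - k) / (v - 1)) * (v / (v + k - 1))"
    proof -
      have "1 / (3 * k) \<le> v / ((v - 1) * (v + k - 1))"
      proof -
        have "1 / (3 * k) \<le> 1 / (v + k - 1)" using kv by (intro divide_left_mono) auto
        also have "\<dots> \<le> v / (v - 1) * (1 / (v + k - 1))" 
          using mult_right_mono[of 1 "v / (v - 1)" "1 / (v + k - 1)"] kv by simp
        finally show ?thesis by simp
      qed
      then have 1: "d * (1 / (3 * k)) \<le> d * (v / ((v - 1) * (v + k - 1)))" using kv by (intro mult_left_mono) auto
      have 2: "3 / 4 * (1 / k\<^sup>2) \<le> (1 - 1 / k\<^sup>2) * (1 / k\<^sup>2)"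
        using kk by (intro mult_right_mono) linarith+
      have "d / (4 * k ^ 3) = (3 / 4 * (1 / k\<^sup>2)) * (d * (1 / (3 * k)))" unfolding k3 by simp
      also have "\<dots> \<le> ((1 - 1 / k\<^sup>2) * (1 / k\<^sup>2)) * (d * (v / ((v - 1) * (v + k - 1))))"
        by (rule mult_mono[OF 2 1]) (use k2 kv in auto)
      also have "\<dots> = (1 - 1 / k\<^sup>2) * (1 - (1 - 1 / k\<^sup>2)) * ((v - k) / (v - 1)) * (v / (v + k - 1))"
        by (simp add: d_def mult.assoc)
      finally show ?thesis using e by linarith
    qed
    show "1 - v / (v + k - 1) * ((v - 1) / (v + k - 2)) +
        (v / (v + k - 1))\<^sup>2 * ((k - 1) * v / ((v - 1) * (v + 1))) \<le> (1 - e)\<^sup>2"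
      using bounds(1) e_small kv by linarith
    show "(v / (v + k - 1))\<^sup>2 * ((k - 1) * v / ((v - 1) * (v + 1))) * (1 + k / (v - 1))\<^sup>2 / (k / (v - 1))
        \<le> (1 - e)\<^sup>2"
    proof -
      have cancel: "(v / m)\<^sup>2 * ((k - 1) * v / (s * (v + 1))) * (m / s)\<^sup>2 / (k / s)
          = v ^ 3 * (k - 1) / (k * (s\<^sup>2 * (v + 1)))" if "m \<noteq> 0" "s \<noteq> 0" for m s :: real
        using that by (simp add: power_divide power2_eq_square power3_eq_cube mult_ac)
      have "1 + k / (v - 1) = (v + k - 1) / (v - 1)" using kv by (simp add: field_simps)
      then have "(v / (v + k - 1))\<^sup>2 * ((k - 1) * v / ((v - 1) * (v + 1))) * (1 + k / (v - 1))\<^sup>2 / (k / (v - 1))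
        = v ^ 3 * (k - 1) / (k * ((v - 1)\<^sup>2 * (v + 1)))"
        using cancel[of "v + k - 1" "v - 1"] kv by simp
      also have "\<dots> \<le> 1 - d / (2 * k ^ 3)"
      proof -
        \<comment> \<open>For \<open>D = (v - 1)^2 * (v + 1)\<close> the deficit
          \<open>k * D - v^3 * (k - 1)\<close> equals \<open>d * v^2 - k * (v - 1)\<close>. This
          inequality leaves at least \<open>d * v^2 / k\<close> of it.\<close>
        have dv: "k * (k * (v - 1)) \<le> (k - 1) * (d * v\<^sup>2)"
        proof -
          have "k * k \<le> (k - 1) * (k + 2)" using kv by (simp add: algebra_simps)
          then have "k * k * (v - 1) \<le> (k - 1) * (k + 2) * (v - 1)" using kv by (intro mult_right_mono) auto
          also have "\<dots> = (k - 1) * (1 * ((k + 2) * (v - 1)))" by simp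
          also have "\<dots> \<le> (k - 1) * (d * v\<^sup>2)"
          proof (intro mult_left_mono mult_mono)
            have "(k + 2) * (v - 1) \<le> (v + 1) * (v - 1)" using kv by (intro mult_right_mono) auto
            then show "(k + 2) * (v - 1) \<le> v\<^sup>2" by (simp add: algebra_simps power2_eq_square)
          qed (use kv in auto)
          finally show ?thesis by (simp add: mult.assoc)
        qed
        have "d * ((v - 1)\<^sup>2 * (v + 1)) \<le> d * (v\<^sup>2 * (2 * k))"
        proof (intro mult_left_mono)
          have "(v - 1)\<^sup>2 * (v + 1) = v\<^sup>2 * v - (v\<^sup>2 + v - 1)" by (simp add: power2_eq_square algebra_simps)
          also have "\<dots> \<le> v\<^sup>2 * v" using kv zero_le_power2[of v] by linarith
          also have "\<dots> \<le> v\<^sup>2 * (2 * k)" using kv by (intro mult_left_mono) auto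
          finally show "(v - 1)\<^sup>2 * (v + 1) \<le> v\<^sup>2 * (2 * k)" .
        qed (use kv in auto)
        also have "\<dots> = 2 * k\<^sup>2 * (d * v\<^sup>2) - 2 * k * ((k - 1) * (d * v\<^sup>2))"
          by (simp add: power2_eq_square algebra_simps)
        also have "\<dots> \<le> 2 * k\<^sup>2 * (d * v\<^sup>2) - 2 * k * (k * (k * (v - 1)))"
          using dv kv by simp
        also have "\<dots> = 2 * k\<^sup>2 * (k * ((v - 1)\<^sup>2 * (v + 1)) - v ^ 3 * (k - 1))"
          unfolding d_def by (simp add: power2_eq_square power3_eq_cube algebra_simps)
        finally have main: "d * ((v - 1)\<^sup>2 * (v + 1)) \<le> 2 * k\<^sup>2 * (k * ((v - 1)\<^sup>2 * (v + 1)) - v ^ 3 * (k - 1))" .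
        define D where "D = (v - 1)\<^sup>2 * (v + 1)"
        have D: "0 < D" using kv by (simp add: D_def)
        have "d / (2 * k ^ 3) = d * D / (2 * k\<^sup>2 * (k * D))" unfolding k3 using D by simp
        also have "\<dots> \<le> 2 * k\<^sup>2 * (k * D - v ^ 3 * (k - 1)) / (2 * k\<^sup>2 * (k * D))"
          using main D kv unfolding D_def[symmetric] by (intro divide_right_mono) auto
        also have "\<dots> = 1 - v ^ 3 * (k - 1) / (k * D)" using D kv by (simp add: diff_divide_distrib)
        finally show ?thesis by (simp add: D_def)
      qed
      also have "\<dots> \<le> 1 - 2 * e" using e by simp
      also have "\<dots> \<le> (1 - e)\<^sup>2" by (simp add: power2_eq_square algebra_simps)
      finally show ?thesis .
    qed
    show "2 * (if r \<le> 2 * l + 1 then k / (v - 1) * ((v / (v + k - 1))\<^sup>2 * ((k - 1) * v / ((v - 1) * (v + 1))))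
        else ((k - 1) / (v + 1))\<^sup>2) \<le> (1 - 1 / k\<^sup>2) * (v / (v + k - 1))"
      using bounds(2) assms(3) kv by simp
    show "(v / (v + k - 1))\<^sup>2 * ((k - 1) * v / ((v - 1) * (v + 1))) \<le> ((1 - 1 / k\<^sup>2) * (v / (v + k - 1)))\<^sup>2"
      using bounds(3) kv by simp
    show "((v / (v + k - 1))\<^sup>2 * ((k - 1) * v / ((v - 1) * (v + 1))) +
        (if r \<le> 2 * l + 1 then k / (v - 1) * ((v / (v + k - 1))\<^sup>2 * ((k - 1) * v / ((v - 1) * (v + 1))))
         else ((k - 1) / (v + 1))\<^sup>2)) *
        (1 + 1 / ((1 - 1 / k\<^sup>2) * (v / (v + k - 1))) -
          (if r \<le> 2 * l + 1 then k / (v - 1) * ((v / (v + k - 1))\<^sup>2 * ((k - 1) * v / ((v - 1) * (v + 1))))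
           else ((k - 1) / (v + 1))\<^sup>2) / ((1 - 1 / k\<^sup>2) * (v / (v + k - 1)))\<^sup>2) \<le> (1 - e)\<^sup>2"
      unfolding if_P[OF assms(3)] by (rule order.trans[OF bounds(4) e_small]) (use kv in simp)
  qed
qed

text \<open>The margins are now constants. \<open>v > 2 k\<close> gives \<open>x >= 2/3\<close>, and
  \<open>v <= 3 k\<close> bounds the base of the power by 5/7; since
  \<open>(5/7)^11 < 1/40 < (5/7)^10\<close>, \<open>e = 1/40\<close> goes with
  \<open>11 <= l\<close>. The factor 625/624 comes from \<open>v >= 25\<close>.\<close>

lemma hm_parameters_large_unbalanced:
  assumes "11 \<le> l" "2 * l + 1 < r" "r \<le> 3 * l + 2"
  shows "hm_parameters l r (9 / 10)"
proof -
  define k v where "k = real l + 1" and "v = real r + 1"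
  have kv: "12 \<le> k" "2 * k + 1 \<le> v" "v \<le> 3 * k"
    using assms by (auto simp: k_def v_def)
  define x where "x = v / (v + k - 1)"
  define \<kappa> where "\<kappa> = x\<^sup>2 * ((k - 1) * v / ((v - 1) * (v + 1)))"
  define w where "w = (if r \<le> 2 * l + 1 then k / (v - 1) * \<kappa> else ((k - 1) / (v + 1))\<^sup>2)"
  have w: "w = ((k - 1) / (v + 1))\<^sup>2" using assms by (simp add: w_def)
  have x: "2 / 3 \<le> x" "x \<le> 1" using kv by (auto simp: x_def field_simps)
  have \<kappa>: "0 \<le> \<kappa>" "\<kappa> \<le> 223 / 1000"
  proof -
    show "0 \<le> \<kappa>" using kv by (simp add: \<kappa>_def)
    have "(k - 1) / (v + k - 1) = 1 - x" using kv by (simp add: x_def field_simps)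
    moreover have "\<kappa> = x * ((k - 1) / (v + k - 1)) * (v\<^sup>2 / ((v - 1) * (v + 1)))"
      unfolding \<kappa>_def by (subst (2) power2_eq_square, subst power2_eq_square, subst x_def) simp
    ultimately have "\<kappa> = x * (1 - x) * (v\<^sup>2 / ((v - 1) * (v + 1)))" by simp
    also have "\<dots> \<le> 2 / 9 * (625 / 624)"
    proof (rule mult_mono)
      have "0 \<le> (3 * x - 2) * (3 * x - 1)" using x by simp
      then show "x * (1 - x) \<le> 2 / 9" by (simp add: algebra_simps)
      have "25 * 25 \<le> v * v" using kv by (intro mult_mono) auto
      then show "v\<^sup>2 / ((v - 1) * (v + 1)) \<le> 625 / 624"
        using kv by (simp add: field_simps power2_eq_square)
    qed (use kv x in auto)
    also have "\<dots> \<le> 223 / 1000" by simp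
    finally show "\<kappa> \<le> 223 / 1000" .
  qed
  have w4: "0 \<le> w" "w \<le> 1 / 4"
  proof -
    have "((k - 1) / (v + 1))\<^sup>2 \<le> (1 / 2)\<^sup>2" using kv by (intro power_mono) (auto simp: divide_simps)
    then show "w \<le> 1 / 4" unfolding w by (simp add: power2_eq_square)
  qed (simp add: w)
  show ?thesis
  proof (rule hm_parametersI[OF k_def v_def x_def \<kappa>_def w_def, where e = "1 / 40"])
    show "3 \<le> l" "l < r" using assms by auto
    have "((2 * v - k) / (2 * v + k)) ^ l \<le> (5 / 7) ^ l"
      using kv by (intro power_mono) (auto simp: divide_simps)
    also have "\<dots> \<le> (5 / 7) ^ 11" using assms(1) by (intro power_decreasing) auto
    also have "\<dots> \<le> (1 / 40 :: real)" by (simp add: power_divide)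
    finally show "((2 * v - k) / (2 * v + k)) ^ l \<le> 1 / 40" .
    have "1 / 2 \<le> (v - k) / (v - 1)" using kv by (simp add: field_simps)
    then have "1 / 2 * (2 / 3) \<le> (v - k) / (v - 1) * x" using x kv by (intro mult_mono) auto
    then have "9 / 100 * (1 / 3) \<le> 9 / 100 * ((v - k) / (v - 1) * x)" by (intro mult_left_mono) auto
    also have "\<dots> = 9 / 10 * (1 - 9 / 10) * ((v - k) / (v - 1)) * x" by simp
    finally show "1 / 40 \<le> 9 / 10 * (1 - 9 / 10) * ((v - k) / (v - 1)) * x" by (rule order.trans[rotated]) simp
    have "2 / 3 \<le> (v - 1) / (v + k - 2)" using kv by (simp add: field_simps)
    then have "2 / 3 * (2 / 3) \<le> x * ((v - 1) / (v + k - 2))" using x by (intro mult_mono) auto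
    then show "1 - x * ((v - 1) / (v + k - 2)) + \<kappa> \<le> (1 - 1 / 40)\<^sup>2"
      using \<kappa> by (simp add: power2_eq_square)
    show "2 * w \<le> 9 / 10 * x" using w4 x by simp
    have "(9 / 10 * (2 / 3))\<^sup>2 \<le> (9 / 10 * x)\<^sup>2" using x by (intro power_mono) auto
    then show "\<kappa> \<le> (9 / 10 * x)\<^sup>2" using \<kappa> by (simp add: power2_eq_square)
    \<comment> \<open>The worst values are \<open>w = 1/4\<close> and \<open>x = 2/3\<close>; the
      latter gives \<open>5/3\<close> for the reciprocal of \<open>9/10 * x\<close>.\<close>
    have "(\<kappa> + w) * (1 + 1 * (1 / (9 / 10 * x)) - w * (1 / (9 / 10 * x))\<^sup>2)
        \<le> (\<kappa> + 1 / 4) * (1 + 1 * (5 / 3) - 1 / 4 * (5 / 3)\<^sup>2)"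
      using \<kappa> w4 x by (intro unbalanced_mono) (auto simp: field_simps power2_eq_square)
    also have "\<dots> \<le> (223 / 1000 + 1 / 4) * (1 + 1 * (5 / 3) - 1 / 4 * (5 / 3)\<^sup>2)"
      using \<kappa> by (intro mult_right_mono) (auto simp: power2_eq_square)
    also have "\<dots> \<le> (1 - 1 / 40)\<^sup>2" by (simp add: power2_eq_square)
    finally show "(\<kappa> + w) * (1 + 1 / (9 / 10 * x) - w / (9 / 10 * x)\<^sup>2) \<le> (1 - 1 / 40)\<^sup>2"
      by (simp add: power_divide)
  qed (use assms in auto)
qed

text \<open>\<open>e\<close> is set equal to the right side of the excess condition, so that
  condition holds automatically and \<open>\<alpha>\<close> is the only free choice. For numerical
  \<open>l\<close>, \<open>r\<close> and \<open>\<alpha>\<close> the rest is rational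
  arithmetic.\<close>

definition small_case :: "nat \<Rightarrow> nat \<Rightarrow> real \<Rightarrow> bool" where
  "small_case l r \<alpha> \<longleftrightarrow>
    (let k = real l + 1; v = real r + 1; x = v / (v + k - 1);
       \<kappa> = x\<^sup>2 * ((k - 1) * v / ((v - 1) * (v + 1)));
       w = (if r \<le> 2 * l + 1 then k / (v - 1) * \<kappa> else ((k - 1) / (v + 1))\<^sup>2);
       e = \<alpha> * (1 - \<alpha>) * ((v - k) / (v - 1)) * x
     in 3 \<le> l \<and> l < r \<and> 1 / 2 \<le> \<alpha> \<and> \<alpha> < 1 \<and> e \<le> 1 \<and> ((2 * v - k) / (2 * v + k)) ^ l \<le> e \<and>
       1 - x * ((v - 1) / (v + k - 2)) + \<kappa> \<le> (1 - e)\<^sup>2 \<and>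
       (r \<le> 2 * l + 1 \<longrightarrow> \<kappa> * (1 + k / (v - 1))\<^sup>2 / (k / (v - 1)) \<le> (1 - e)\<^sup>2) \<and>
       2 * w \<le> \<alpha> * x \<and> \<kappa> \<le> (\<alpha> * x)\<^sup>2 \<and>
       (\<kappa> + w) * (1 + 1 / (\<alpha> * x) - w / (\<alpha> * x)\<^sup>2) \<le> (1 - e)\<^sup>2)"

lemma hm_parameters_small_case: "small_case l r \<alpha> \<Longrightarrow> hm_parameters l r \<alpha>"
  unfolding small_case_def Let_def
  by (rule hm_parametersI[OF refl refl refl refl refl, where e =
      "\<alpha> * (1 - \<alpha>) * ((real r + 1 - (real l + 1)) / (real r + 1 - 1)) * ((real r + 1) / (real r + 1 + (real l + 1) - 1))"])
    (simp_all only:)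

text \<open>The formula for \<open>\<alpha>\<close> is a fit: \<open>1 - \<alpha>\<close> must be
  large enough for \<open>e\<close> to dominate the power and small enough for
  \<open>(1 - e)^2\<close> to stay above the balanced bound, whose margin grows with
  \<open>r - l\<close>.\<close>

lemma small_case_balanced:
  "\<forall>l\<in>set [7..<15]. \<forall>r\<in>set [l + 1..<2 * l + 2].
    small_case l r (1 - 5 * (real r - real l + 1) / (8 * (real l + 1)\<^sup>2))"
  by (simp del: set_upt, intro conjI) (simp_all add: small_case_def Let_def power_divide)

lemma small_case_unbalanced:
  "\<forall>l\<in>set [7..<11]. \<forall>r\<in>set [2 * l + 2..<3 * l + 3]. small_case l r (1 - 7 / (4 * real l))"
  by (simp del: set_upt, intro conjI) (simp_all add: small_case_def Let_def power_divide)

lemma hm_parameters_exist: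
  assumes "7 \<le> l" "l < r" "r \<le> 3 * l + 2"
  shows "\<exists>\<alpha>. hm_parameters l r \<alpha>"
proof (cases "r \<le> 2 * l + 1")
  case r: True
  show ?thesis
  proof (cases "l < 15")
    case True
    then have "l \<in> set [7..<15]" "r \<in> set [l + 1..<2 * l + 2]" using assms r by auto
    then show ?thesis using small_case_balanced hm_parameters_small_case by blast
  next
    case False
    then show ?thesis using hm_parameters_large_balanced[of l r] assms r by auto
  qed
next
  case r: False
  show ?thesis
  proof (cases "l < 11")
    case True
    then have "l \<in> set [7..<11]" "r \<in> set [2 * l + 2..<3 * l + 3]" using assms r by auto
    then show ?thesis using small_case_unbalanced hm_parameters_small_case by blast
  next
    case False
    then show ?thesis using hm_parameters_large_unbalanced[of l r] assms r by auto
  qed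
qed

theorem theorem1p6:
  fixes n k :: nat and F G :: "nat set set"
  assumes "k \<ge> 8" and "2 * k + 1 \<le> n" and "n \<le> 4 * k"
    and "F \<subseteq> {A. A \<subseteq> {1..n} \<and> card A = k}"
    and "G \<subseteq> {A. A \<subseteq> {1..n} \<and> card A = k}"
    and "cross_intersecting F G"
    and "non_trivial F" and "non_trivial G"
  shows "card F * card G \<le> ((n - 1 choose (k - 1)) - (n - k - 1 choose (k - 1)) + 1)\<^sup>2"
proof -
  define l r where "l = k - 1" and "r = n - k - 1"
  have k: "k = Suc l" and n: "n = Suc (Suc (l + r))" using assms(1,2) by (auto simp: l_def r_def)
  have "7 \<le> l" "l < r" "r \<le> 3 * l + 2" using assms(1-3) k n by auto
  then obtain \<alpha> where "hm_parameters l r \<alpha>" using hm_parameters_exist by blast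
  then have "real (card F) * real (card G) \<le> (real (Suc (l + r) choose l) - real (r choose l) + 1)\<^sup>2"
    by (rule hm_parameters.non_trivial_product_bound[OF _ assms(4,5)[unfolded k] n assms(6-8)])
  also have "real (Suc (l + r) choose l) - real (r choose l) + 1
      = real ((Suc (l + r) choose l) - (r choose l) + 1)"
  \<comment> \<open>The truncated subtraction of naturals is exact here, because
    \<open>r choose l\<close> is at most the binomial it is taken from.\<close>
  proof -
    have "r choose l \<le> Suc (l + r) choose l" by (rule binomial_right_mono) simp
    then show ?thesis by (simp add: of_nat_diff del: binomial_Suc_Suc)
  qed
  finally have "real (card F * card G) \<le> real (((Suc (l + r) choose l) - (r choose l) + 1)\<^sup>2)"
    by (simp del: binomial_Suc_Suc)
  then have "card F * card G \<le> ((Suc (l + r) choose l) - (r choose l) + 1)\<^sup>2" by (simp only: of_nat_le_iff)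
  moreover have "n - 1 = Suc (l + r)" "n - k - 1 = r" "k - 1 = l" using k n by auto
  ultimately show ?thesis by (simp only:)
qed

end
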